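(* Let $n\ge3$ and $1<p<\infty$. For every $L\in\mathcal{S}^n$ and every $\tau\in[-1,1]$, $$V(\mathrm{M}_pL)\ge V(\mathrm{M}_p^\tau L)\ge V(\mathrm{M}_p^{\pm}L).$$ If $L$ is not origin-symmetric and $p$ is not an odd integer, there is equality in the left inequality if and only if $\tau=0$ and equality in the right inequality if and only if $\tau=\pm1$.
   Context: $V$ is volume in $\mathbb{R}^n$. For a compact set $L\subset\mathbb{R}^n$ star-shaped with respect to the origin, the radial function is $\rho(L,x)=\max\{\lambda\ge0:\lambda x\in L\}$, $x\in\mathbb{R}^n\setminus\{0\}$; $L$ is a star body if $\rho(L,\cdot)$ is positive and continuous. $\mathcal{S}^n$ is the set of star bodies in $\mathbb{R}^n$. $L$ is origin-symmetric if $L=-L$. The support function of a convex body $K$ is $h(K,x)=\max\{x\cdot y:y\in K\}$. Let $c_{n,p}=\dfrac{\Gamma\left(\frac{n+p}{2}\right)}{\pi^{(n-1)/2}\,\Gamma\left(\frac{1+p}{2}\right)}$ and, for $\tau\in[-1,1]$, $c_{n,p}(\tau)=\dfrac{c_{n,p}}{(1+\tau)^p+(1-\tau)^p}$ and $\varphi_\tau(t)=|t|+\tau t$. For $L\in\mathcal{S}^n$, $\mathrm{M}_p^\tau L$ is the convex body (containing the origin in its interior) with $$h(\mathrm{M}_p^\tau L,u)^p=c_{n,p}(\tau)\int_{S^{n-1}}\varphi_\tau(u\cdot v)^p\,\rho(L,v)^{n+p}\,dv,\qquad u\in S^{n-1},$$ where $dv$ is spherical Lebesgue measure. The nonsymmetric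 $L_p$ moment bodies are given by $h(\mathrm{M}_p^+L,u)^p=c_{n,p}\int_{S^{n-1}}(\max\{u\cdot v,0\})^p\rho(L,v)^{n+p}\,dv$ and $\mathrm{M}_p^-L=\mathrm{M}_p^+(-L)=-\mathrm{M}_p^+L$; thus $\mathrm{M}_p^{\pm}=\mathrm{M}_p^\tau$ for $\tau=\pm1$. The symmetric $L_p$ moment body is $\mathrm{M}_pL=\mathrm{M}_p^0L$, i.e. $h(\mathrm{M}_pL,\cdot)^p=\frac12h(\mathrm{M}_p^+L,\cdot)^p+\frac12h(\mathrm{M}_p^-L,\cdot)^p$. The inequality with $\pm$ is asserted for each sign (the two volumes $V(\mathrm{M}_p^{+}L)$ and $V(\mathrm{M}_p^{-}L)$ coincide). *)

theory Defs
  imports "HOL-Analysis.Analysis"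
begin

text \<open>For compact \<open>L\<close> star-shaped at the origin and \<open>x \<noteq> 0\<close> the supremum is a maximum.\<close>

definition radial :: "'a::euclidean_space set \<Rightarrow> 'a \<Rightarrow> real" where
  "radial L x = Sup {l. 0 \<le> l \<and> l *\<^sub>R x \<in> L}"

text \<open>The library's \<open>starlike\<close> allows an arbitrary centre; here the centre is the origin.\<close>

definition star_body :: "'a::euclidean_space set \<Rightarrow> bool" where
  "star_body L \<longleftrightarrow>
     compact L \<and> 0 \<in> L \<and> (\<forall>x\<in>L. closed_segment 0 x \<subseteq> L) \<and>
     (\<forall>x. x \<noteq> 0 \<longrightarrow> 0 < radial L x) \<and> continuous_on (- {0}) (radial L)"

definition origin_symmetric :: "'a::euclidean_space set \<Rightarrow> bool" where
  "origin_symmetric L \<longleftrightarrow> L = uminus ` L"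

definition support_fun :: "'a::euclidean_space set \<Rightarrow> 'a \<Rightarrow> real" where
  "support_fun K x = (SUP y\<in>K. x \<bullet> y)"

text \<open>Spherical Lebesgue measure on the unit sphere, as the cone measure
  \<open>\<sigma>(A) = n \<lambda>{x. 0 < \<bar>x\<bar> \<le> 1 \<and> x / \<bar>x\<bar> \<in> A}\<close>; this is the normalisation for which
  integration in polar coordinates has the density \<open>r ^ (n - 1)\<close>, i.e. the total mass is
  the surface area of the unit ball.\<close>

definition spherical_measure :: "'a::euclidean_space measure" where
  "spherical_measure =
     scale_measure (of_nat DIM('a))
       (distr (restrict_space lborel (cball 0 1 - {0})) (restrict_space borel (sphere 0 1)) sgn)"

definition moment_const :: "nat \<Rightarrow> real \<Rightarrow> real" where
  "moment_const n p =
     Gamma ((real n + p) / 2) / (pi powr ((real n - 1) / 2) * Gamma ((1 + p) / 2))"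

definition moment_const_tau :: "nat \<Rightarrow> real \<Rightarrow> real \<Rightarrow> real" where
  "moment_const_tau n p \<tau> = moment_const n p / ((1 + \<tau>) powr p + (1 - \<tau>) powr p)"

definition phi_tau :: "real \<Rightarrow> real \<Rightarrow> real" where
  "phi_tau \<tau> t = \<bar>t\<bar> + \<tau> * t"

text \<open>The convex body \<open>K\<close> with the origin in its interior and \<open>h(K,u)\<^sup>p = f(u)\<close> for all unit
  vectors \<open>u\<close>. A convex body is determined by its support function on the unit sphere, so there is
  at most one.\<close>

definition body_of_support_powr :: "real \<Rightarrow> ('a::euclidean_space \<Rightarrow> real) \<Rightarrow> 'a set" where
  "body_of_support_powr p f =
     (THE K. compact K \<and> convex K \<and> 0 \<in> interior K \<and>
        (\<forall>u\<in>sphere 0 1. support_fun K u powr p = f u))"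

definition moment_body_tau :: "real \<Rightarrow> real \<Rightarrow> 'a::euclidean_space set \<Rightarrow> 'a set" where
  "moment_body_tau p \<tau> L =
     body_of_support_powr p
       (\<lambda>u. moment_const_tau DIM('a) p \<tau> *
          (\<integral>v. phi_tau \<tau> (u \<bullet> v) powr p * radial L v powr (real DIM('a) + p) \<partial>spherical_measure))"

definition moment_body_plus :: "real \<Rightarrow> 'a::euclidean_space set \<Rightarrow> 'a set" where
  "moment_body_plus p L =
     body_of_support_powr p
       (\<lambda>u. moment_const DIM('a) p *
          (\<integral>v. max (u \<bullet> v) 0 powr p * radial L v powr (real DIM('a) + p) \<partial>spherical_measure))"

definition moment_body_minus :: "real \<Rightarrow> 'a::euclidean_space set \<Rightarrow> 'a set" where
  "moment_body_minus p L = moment_body_plus p (uminus ` L)"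

definition moment_body :: "real \<Rightarrow> 'a::euclidean_space set \<Rightarrow> 'a set" where
  "moment_body p L = moment_body_tau p 0 L"

end

theory Submission
  imports Defs "HOL-Probability.Probability"
begin

text \<open>
  The nonsymmetric bodies \<open>K = M\<^sub>p\<^sup>+ L\<close> and \<open>- K = M\<^sub>p\<^sup>- L\<close> generate the whole family: since
  \<open>\<phi>\<^sub>\<tau>(t)\<^sup>p = (1 + \<tau>)\<^sup>p max(t, 0)\<^sup>p + (1 - \<tau>)\<^sup>p max(- t, 0)\<^sup>p\<close>, the body for the parameter \<open>\<tau>\<close> is the
  \<open>L\<^sub>p\<close> (Firey) combination of \<open>K\<close> and \<open>- K\<close> with a weight \<open>l\<close> that is 0, 1/2 or 1 exactly
  for \<open>\<tau> = - 1\<close>, \<open>0\<close>, \<open>1\<close>. By the power mean inequality an \<open>L\<^sub>p\<close> combination of a body with its reflection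
  contains their Minkowski combination, and by Brunn--Minkowski the latter has at least the volume of the body.
  Applied to \<open>K\<close> this is the right inequality. Applied to the body for \<open>\<tau>\<close>, whose equally weighted combination
  with its reflection is the symmetric body, it is the left inequality. This is
  \<open>volume_Firey_symmetrization\<close>, resting on \<open>Brunn_Minkowski_multiplicative\<close>, which is proved through the
  Prekopa--Leindler inequality.

  Equality of volumes forces the \<open>L\<^sub>p\<close> combination and the Minkowski combination to be the same body, so the power mean
  and the arithmetic mean of the two support functions agree; by strict convexity of \<open>t\<^sup>p\<close> the body
  is origin-symmetric. Apart from the trivial values of \<open>\<tau>\<close> this makes \<open>K\<close> symmetric, which says that
  the integrals of \<open>sgn(u \<bullet> v) \<bar>u \<bullet> v\<bar>\<^sup>p \<rho>(L, v)\<^bsup>n + p\<^esup>\<close> over the sphere vanish for all \<open>u\<close>. For \<open>p\<close> not an odd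
  integer it follows that \<open>\<rho>(L, \<cdot>)\<close> is even (\<open>even_if_odd_powr_transform_zero\<close>), that is, \<open>L\<close> is
  origin-symmetric.

  For this injectivity the integral is averaged over
  \<open>u = w + x\<close> with \<open>x\<close> a standard Gaussian vector. By rotation invariance the kernel turns into
  \<open>\<Phi>(w \<bullet> v)\<close>, where \<open>\<Phi>\<close> is the convolution of \<open>sgn(t) \<bar>t\<bar>\<^sup>p\<close> with the Gaussian density on the line. This \<open>\<Phi>\<close> is an
  odd entire function, essentially a confluent hypergeometric one, and its Taylor coefficients obey a two-term
  recurrence whose factors vanish only when \<open>p\<close> is an odd integer. Otherwise all odd moments
  of the density \<open>\<rho>(L, \<cdot>)\<^bsup>n + p\<^esup>\<close> vanish, its odd part is orthogonal to all exponentials, and Stone--Weierstrass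
  finishes the argument.

  The moment bodies are defined by description, so their existence has to be shown as well. The body is
  the Wulff shape of the prescribed support function, and Hoelder's inequality shows that the gradient of that
  function in each direction is a point of contact (\<open>exists_moment_body\<close>).
\<close>

section \<open>The inequalities of Prekopa--Leindler and Brunn--Minkowski\<close>

text \<open>The one-dimensional Brunn--Minkowski inequality: a translate of \<open>l A\<close> that ends at the point
  \<open>l max A + (1 - l) min B\<close> and a translate of \<open>(1 - l) B\<close> that begins there both lie in
  \<open>l A + (1 - l) B\<close>, and they overlap in a single point.\<close>

lemma measure_Minkowski_real_compact:
  fixes A B C :: "real set"
  assumes "compact A" "compact B" "A \<noteq> {}" "B \<noteq> {}" "C \<in> fmeasurable lborel" "0 < l" "l < 1"
    and C: "\<And>x y. x \<in> A \<Longrightarrow> y \<in> B \<Longrightarrow> l * x + (1 - l) * y \<in> C"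
  shows "l * measure lborel A + (1 - l) * measure lborel B \<le> measure lborel C"
proof -
  obtain a where a: "a \<in> A" "\<And>x. x \<in> A \<Longrightarrow> x \<le> a"
    using compact_attains_sup[OF assms(1,3)] by blast
  obtain b where b: "b \<in> B" "\<And>x. x \<in> B \<Longrightarrow> b \<le> x"
    using compact_attains_inf[OF assms(2,4)] by blast
  \<comment> \<open>The two translates, meeting at \<open>l * a + (1 - l) * b\<close>.\<close>
  define A' where "A' = (\<lambda>x. (1 - l) * b + l * x) ` A"
  define B' where "B' = (\<lambda>x. l * a + (1 - l) * x) ` B"
  have comp: "compact A'" "compact B'"
    unfolding A'_def B'_def by (intro compact_continuous_image continuous_intros assms)+
  have scale: "measure lborel ((\<lambda>x. c + r * x) ` S) = r * measure lborel S"
    if "r > 0" "compact S" for c r :: real and S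
  proof -
    have "measure lebesgue ((\<lambda>x. c + r * x) ` S) = r * measure lebesgue S"
      using that measure_lebesgue_affine[of r c S] by (simp add: add.commute[of c])
    moreover have "compact ((\<lambda>x. c + r * x) ` S)"
      using that by (intro compact_continuous_image continuous_intros)
    ultimately show ?thesis using that
      by (metis borel_compact measure_completion sets_lborel)
  qed
  have sub: "A' \<union> B' \<subseteq> C"
    unfolding A'_def B'_def using a b C by (auto simp: add.commute)
  have int: "A' \<inter> B' \<subseteq> {l * a + (1 - l) * b}"
  proof
    fix z assume "z \<in> A' \<inter> B'"
    then obtain x y where *: "x \<in> A" "y \<in> B" "z = (1 - l) * b + l * x" "z = l * a + (1 - l) * y"
      unfolding A'_def B'_def by auto
    have "l * x \<le> l * a" "(1 - l) * b \<le> (1 - l) * y"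
      using a(2)[OF *(1)] b(2)[OF *(2)] assms by (auto intro: mult_left_mono)
    then have "l * x = l * a" using * by linarith
    then show "z \<in> {l * a + (1 - l) * b}" using * by simp
  qed
  have m: "A' \<in> fmeasurable lborel" "B' \<in> fmeasurable lborel"
    using comp by (auto intro!: fmeasurableI emeasure_bounded_finite compact_imp_bounded borel_compact)
  have "emeasure lborel (A' \<inter> B') \<le> emeasure lborel {l * a + (1 - l) * b}"
    by (intro emeasure_mono int) auto
  then have 0: "measure lborel (A' \<inter> B') = 0"
    by (simp add: measure_def)
  have "measure lborel (A' \<union> B') = measure lborel A' + measure lborel B' - measure lborel (A' \<inter> B')"
    using m by (intro measure_Un3)
  moreover have "measure lborel (A' \<union> B') \<le> measure lborel C"
    using fmeasurableD[OF fmeasurable.Un[OF m]] assms(5) by (intro measure_mono_fmeasurable sub)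
  ultimately have "measure lborel A' + measure lborel B' \<le> measure lborel C" using 0 by simp
  then show ?thesis
    unfolding A'_def B'_def using assms by (simp add: scale)
qed

lemma measure_Minkowski_real:
  fixes A B C :: "real set"
  assumes "A \<in> sets borel" "B \<in> sets borel" "bounded A" "bounded B" "A \<noteq> {}" "B \<noteq> {}"
    "C \<in> fmeasurable lborel" "0 < l" "l < 1"
    and C: "\<And>x y. x \<in> A \<Longrightarrow> y \<in> B \<Longrightarrow> l * x + (1 - l) * y \<in> C"
  shows "l * measure lborel A + (1 - l) * measure lborel B \<le> measure lborel C"
proof -
  have inner: "\<exists>T. compact T \<and> T \<noteq> {} \<and> T \<subseteq> S \<and> measure lborel S \<le> measure lborel T + e"
    if S: "S \<in> sets borel" "bounded S" "S \<noteq> {}" and e: "e > 0" for S :: "real set" and e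
  proof -
    obtain T where T: "closed T" "T \<subseteq> S" "emeasure lebesgue (S - T) < ennreal e"
      using sets_lebesgue_inner_closed[OF sets_completionI_sets[of S lborel] e] S by (metis sets_lborel)
    have cT: "compact T" using T S bounded_subset compact_eq_bounded_closed by blast
    have fm: "X \<in> fmeasurable lborel" if "X \<in> sets borel" "bounded X" for X :: "real set"
      using that by (intro fmeasurableI emeasure_bounded_finite) auto
    have fS: "S \<in> fmeasurable lborel" and fT: "T \<in> fmeasurable lborel"
      using S compact_imp_bounded[OF cT] borel_compact[OF cT] by (blast intro: fm)+
    have "emeasure lborel (S - T) < ennreal e"
      using T(3) S(1) borel_compact[OF cT] by simp
    then have "measure lborel (S - T) < e"
      by (metis e emeasure_eq_ennreal_measure ennreal_less_iff measure_nonneg top.extremum_strict)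
    moreover have "measure lborel (S - T) = measure lborel S - measure lborel T"
      by (rule measurable_measure_Diff[OF fS fmeasurableD[OF fT] T(2)])
    ultimately have le: "measure lborel S \<le> measure lborel T + e" by simp
    show ?thesis
    proof (cases "T = {}")
      case True
      obtain s where "s \<in> S" using S by auto
      \<comment> \<open>\<open>S\<close> has measure at most \<open>e\<close> here, and any point of it will do.\<close>
      then show ?thesis using le True by (intro exI[of _ "{s}"]) auto
    qed (use cT T le in blast)
  qed
  show ?thesis
  proof (rule field_le_epsilon)
    fix e :: real assume e: "e > 0"
    obtain S T where ST: "compact S" "S \<noteq> {}" "S \<subseteq> A" "measure lborel A \<le> measure lborel S + e"
      "compact T" "T \<noteq> {}" "T \<subseteq> B" "measure lborel B \<le> measure lborel T + e"
      using inner[OF assms(1,3,5) e] inner[OF assms(2,4,6) e] by blast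
    have "l * measure lborel S + (1 - l) * measure lborel T \<le> measure lborel C"
      using ST assms by (intro measure_Minkowski_real_compact) auto
    moreover have "l * measure lborel A \<le> l * (measure lborel S + e)"
      "(1 - l) * measure lborel B \<le> (1 - l) * (measure lborel T + e)"
      using ST assms by (auto intro!: mult_left_mono)
    ultimately show "l * measure lborel A + (1 - l) * measure lborel B \<le> measure lborel C + e"
      by (simp add: algebra_simps)
  qed
qed

text \<open>Both sides are the planar measure of the region \<open>0 \<le> t < f x\<close>, integrated in the two
  possible orders.\<close>

lemma nn_integral_layer_cake:
  fixes f :: "real \<Rightarrow> real"
  assumes [measurable]: "f \<in> borel_measurable borel" and "\<And>x. 0 \<le> f x" "\<And>x. f x \<le> 1"
  shows "(\<integral>\<^sup>+x. ennreal (f x) \<partial>lborel) =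
    (\<integral>\<^sup>+t. indicator {0..<1} t * emeasure lborel {x. t < f x} \<partial>lborel)"
proof -
  have "(\<integral>\<^sup>+x. ennreal (f x) \<partial>lborel) =
    (\<integral>\<^sup>+x. (\<integral>\<^sup>+t. indicator {0..<1} t * indicator {x. t < f x} x \<partial>lborel) \<partial>lborel)"
  proof (intro nn_integral_cong)
    fix x
    have "(\<integral>\<^sup>+t. indicator {0..<1} t * indicator {x. t < f x} x \<partial>lborel) =
      (\<integral>\<^sup>+t. indicator {0..<f x} t \<partial>lborel)"
      using assms(3)[of x] by (intro nn_integral_cong) (auto simp: indicator_def)
    also have "\<dots> = ennreal (f x)" using assms(2)[of x] by simp
    finally show "ennreal (f x) =
      (\<integral>\<^sup>+t. indicator {0..<1} t * indicator {x. t < f x} x \<partial>lborel)" by simp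
  qed
  also have "\<dots> = (\<integral>\<^sup>+t. (\<integral>\<^sup>+x. indicator {0..<1} t * indicator {x. t < f x} x \<partial>lborel) \<partial>lborel)"
  proof -
    have [measurable]: "(\<lambda>(x, t). indicator {0..<1} t * indicator {x. t < f x} x)
      \<in> borel_measurable (lborel \<Otimes>\<^sub>M (lborel :: real measure))"
      by (simp add: indicator_def)
    show ?thesis using lborel_pair.Fubini'[of "\<lambda>x t. indicator {0..<1} t * indicator {x. t < f x} x"] 
      by simp
  qed
  also have "\<dots> = (\<integral>\<^sup>+t. indicator {0..<1} t * emeasure lborel {x. t < f x} \<partial>lborel)"
    by (intro nn_integral_cong) (simp add: nn_integral_cmult)
  finally show ?thesis .
qed

text \<open>When both functions have supremum 1, every superlevel set at a level \<open>t < 1\<close> is nonempty, so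
  the one-dimensional Brunn--Minkowski inequality applies at each such level; the levels are then
  summed by the layer cake formula. This yields an arithmetic mean of the integrals, which is stronger
  than the geometric mean.\<close>

lemma Prekopa_Leindler_sup_one:
  fixes f g h :: "real \<Rightarrow> real"
  assumes [measurable]: "f \<in> borel_measurable borel" "g \<in> borel_measurable borel" "h \<in> borel_measurable borel"
    and f: "\<And>x. 0 \<le> f x" "\<And>x. f x \<le> 1" "\<And>t. t < 1 \<Longrightarrow> \<exists>x. t < f x" "\<And>x. f x \<noteq> 0 \<Longrightarrow> \<bar>x\<bar> \<le> R"
    and g: "\<And>x. 0 \<le> g x" "\<And>x. g x \<le> 1" "\<And>t. t < 1 \<Longrightarrow> \<exists>x. t < g x" "\<And>x. g x \<noteq> 0 \<Longrightarrow> \<bar>x\<bar> \<le> R"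
    and h: "\<And>x. 0 \<le> h x" "\<And>x. h x \<noteq> 0 \<Longrightarrow> \<bar>x\<bar> \<le> R"
    and l: "0 < l" "l < 1"
    and fgh: "\<And>x y. f x powr l * g y powr (1 - l) \<le> h (l * x + (1 - l) * y)"
  shows "ennreal l * (\<integral>\<^sup>+x. ennreal (f x) \<partial>lborel) + ennreal (1 - l) * (\<integral>\<^sup>+x. ennreal (g x) \<partial>lborel)
    \<le> (\<integral>\<^sup>+x. ennreal (h x) \<partial>lborel)"
proof -
  \<comment> \<open>The layer cake formula covers levels below 1 only, so \<open>h\<close> is cut off there.\<close>
  define h' where "h' = (\<lambda>x. min (h x) 1)"
  have [measurable]: "h' \<in> borel_measurable borel" unfolding h'_def by simp
  have meas: "(\<lambda>t. indicator {0..<1} t * emeasure lborel {x. t < k x}) \<in> borel_measurable lborel"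
    if [measurable]: "k \<in> borel_measurable borel" for k :: "real \<Rightarrow> real"
  proof -
    have "(\<lambda>t. \<integral>\<^sup>+x. indicator {x. t < k x} x \<partial>lborel) \<in> borel_measurable (lborel :: real measure)"
    proof (rule lborel.borel_measurable_nn_integral)
      show "(\<lambda>(t, x). indicator {x. t < k x} x :: ennreal)
        \<in> borel_measurable (lborel \<Otimes>\<^sub>M (lborel :: real measure))"
        by (simp add: indicator_def)
    qed
    then show ?thesis by simp
  qed
  have "ennreal l * (\<integral>\<^sup>+x. ennreal (f x) \<partial>lborel) + ennreal (1 - l) * (\<integral>\<^sup>+x. ennreal (g x) \<partial>lborel)
     = (\<integral>\<^sup>+t. ennreal l * (indicator {0..<1} t * emeasure lborel {x. t < f x}) +
       ennreal (1 - l) * (indicator {0..<1} t * emeasure lborel {x. t < g x}) \<partial>lborel)"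
    using meas[of f] meas[of g] f g
    by (simp add: nn_integral_layer_cake nn_integral_add nn_integral_cmult)
  also have "\<dots> \<le> (\<integral>\<^sup>+t. indicator {0..<1} t * emeasure lborel {x. t < h' x} \<partial>lborel)"
  proof (rule nn_integral_mono)
    fix t :: real
    show "ennreal l * (indicator {0..<1} t * emeasure lborel {x. t < f x}) +
       ennreal (1 - l) * (indicator {0..<1} t * emeasure lborel {x. t < g x})
       \<le> indicator {0..<1} t * emeasure lborel {x. t < h' x}"
    proof (cases "t \<in> {0..<1}")
      case True
      have bd: "bounded {x. t < k x}" if "\<And>x. k x \<noteq> 0 \<Longrightarrow> \<bar>x\<bar> \<le> R" for k :: "real \<Rightarrow> real"
        using True that by (intro boundedI[of _ R]) force
      have bds: "bounded {x. t < f x}" "bounded {x. t < g x}" "bounded {x. t < h' x}"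
        using f(4) g(4) h(2) by (intro bd; force simp: h'_def min_def split: if_splits)+
      have fm: "{x. t < h' x} \<in> fmeasurable lborel"
        using bds by (intro fmeasurableI emeasure_bounded_finite) auto
      have "l * measure lborel {x. t < f x} + (1 - l) * measure lborel {x. t < g x}
        \<le> measure lborel {x. t < h' x}"
      proof (rule measure_Minkowski_real)
        fix x y assume xy: "x \<in> {x. t < f x}" "y \<in> {x. t < g x}"
        have "t < f x powr l * g y powr (1 - l)"
        proof (cases "t = 0")
          case True with xy show ?thesis by simp
        next
          case False
          then have t: "t > 0" using \<open>t \<in> {0..<1}\<close> by simp
          have "t = t powr l * t powr (1 - l)" using t by (simp flip: powr_add)
          also have "\<dots> < f x powr l * g y powr (1 - l)"
            using t xy l by (intro mult_strict_mono powr_less_mono2) auto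
          finally show ?thesis .
        qed
        then show "l * x + (1 - l) * y \<in> {x. t < h' x}"
          using fgh[of x y] True by (auto simp: h'_def)
      next
        show "{x. t < f x} \<noteq> {}" "{x. t < g x} \<noteq> {}" using f(3)[of t] g(3)[of t] True by auto
      qed (use bds fm l in simp_all)
      then have "ennreal (l * measure lborel {x. t < f x} + (1 - l) * measure lborel {x. t < g x})
        \<le> ennreal (measure lborel {x. t < h' x})" by (rule ennreal_leI)
      moreover have em: "emeasure lborel {x. t < k x} = ennreal (measure lborel {x. t < k x})"
        if "bounded {x. t < k x}" for k :: "real \<Rightarrow> real"
        using emeasure_bounded_finite[OF that] by (intro emeasure_eq_ennreal_measure) auto
      moreover have "ennreal l * ennreal (measure lborel {x. t < f x}) +
          ennreal (1 - l) * ennreal (measure lborel {x. t < g x}) =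
          ennreal (l * measure lborel {x. t < f x} + (1 - l) * measure lborel {x. t < g x})"
        using l by (simp add: ennreal_mult')
      ultimately show ?thesis using True
        by (simp add: em[OF bds(1)] em[OF bds(2)] em[OF bds(3)])
    qed auto
  qed
  also have "\<dots> = (\<integral>\<^sup>+x. ennreal (h' x) \<partial>lborel)"
    using h by (subst nn_integral_layer_cake) (auto simp: h'_def)
  also have "\<dots> \<le> (\<integral>\<^sup>+x. ennreal (h x) \<partial>lborel)"
    by (intro nn_integral_mono) (auto simp: h'_def intro!: ennreal_leI)
  finally show ?thesis .
qed

lemma weighted_AM_GM:
  fixes a b l :: real
  assumes "0 \<le> a" "0 \<le> b" "0 < l" "l < 1"
  shows "a powr l * b powr (1 - l) \<le> l * a + (1 - l) * b"
  using Youngs_inequality_0[of l "1 - l" a b] assms by (cases "a = 0 \<or> b = 0") auto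
text \<open>Dividing \<open>f\<close> and \<open>g\<close> by their suprema \<open>a\<close> and \<open>b\<close>, and \<open>h\<close> by \<open>a powr l * b powr (1 - l)\<close>,
  preserves the hypothesis and reduces the claim to functions with supremum 1.\<close>

lemma Prekopa_Leindler_real:
  fixes f g h :: "real \<Rightarrow> real"
  assumes [measurable]: "f \<in> borel_measurable borel" "g \<in> borel_measurable borel" "h \<in> borel_measurable borel"
    and f: "\<And>x. 0 \<le> f x" "\<And>x. f x \<le> C" "\<And>x. f x \<noteq> 0 \<Longrightarrow> \<bar>x\<bar> \<le> R"
    and g: "\<And>x. 0 \<le> g x" "\<And>x. g x \<le> C" "\<And>x. g x \<noteq> 0 \<Longrightarrow> \<bar>x\<bar> \<le> R"
    and h: "\<And>x. 0 \<le> h x" "\<And>x. h x \<le> C" "\<And>x. h x \<noteq> 0 \<Longrightarrow> \<bar>x\<bar> \<le> R"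
    and l: "0 < l" "l < 1"
    and fgh: "\<And>x y. f x powr l * g y powr (1 - l) \<le> h (l * x + (1 - l) * y)"
  shows "(\<integral>x. f x \<partial>lborel) powr l * (\<integral>x. g x \<partial>lborel) powr (1 - l) \<le> (\<integral>x. h x \<partial>lborel)"
proof -
  have int: "integrable lborel k"
    if [measurable]: "k \<in> borel_measurable borel"
      and k: "\<And>x. 0 \<le> k x" "\<And>x. k x \<le> D" "\<And>x. k x \<noteq> 0 \<Longrightarrow> \<bar>x\<bar> \<le> R" for k :: "real \<Rightarrow> real" and D
  proof (rule integrableI_bounded_set[where A="{-R..R}" and B=D])
    show "AE x\<in>{-R..R} in lborel. norm (k x) \<le> D" using k by auto
    show "AE x in lborel. x \<notin> {-R..R} \<longrightarrow> k x = 0" using k(3) by force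
  qed (auto simp: emeasure_lborel_Icc_eq)
  have h0: "0 \<le> (\<integral>x. h x \<partial>lborel)" using h by simp
  define a where "a = (SUP x. f x)"
  define b where "b = (SUP x. g x)"
  have bdd: "bdd_above (range f)" "bdd_above (range g)" using f g by (auto intro!: bdd_aboveI)
  have fa: "f x \<le> a" and gb: "g x \<le> b" for x
    unfolding a_def b_def using bdd by (auto intro!: cSUP_upper)
  have ab: "0 \<le> a" "0 \<le> b" using fa[of 0] gb[of 0] f(1)[of 0] g(1)[of 0] by linarith+
  show ?thesis
  proof (cases "a = 0 \<or> b = 0")
    case True
    then have "(\<forall>x. f x = 0) \<or> (\<forall>x. g x = 0)" using fa gb f(1) g(1) by (metis order_antisym)
    then show ?thesis using h0 by auto
  next
    case False
    then have pos: "0 < a" "0 < b" using ab by auto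
    define c where "c = a powr l * b powr (1 - l)"
    have c: "c > 0" using pos by (simp add: c_def)
    have ineq: "ennreal l * (\<integral>\<^sup>+x. ennreal (f x / a) \<partial>lborel) + ennreal (1 - l) * (\<integral>\<^sup>+x. ennreal (g x / b) \<partial>lborel)
      \<le> (\<integral>\<^sup>+x. ennreal (h x / c) \<partial>lborel)"
    proof (rule Prekopa_Leindler_sup_one)
      show "\<exists>x. t < f x / a" if "t < 1" for t
      proof -
        have "t * a < (SUP x. f x)" using that pos by (simp flip: a_def)
        then obtain x where "t * a < f x" using less_cSUP_iff[OF UNIV_not_empty bdd(1)] by blast
        then have "t < f x / a" using pos by (simp add: pos_less_divide_eq)
        then show ?thesis ..
      qed
      show "\<exists>x. t < g x / b" if "t < 1" for t
      proof -
        have "t * b < (SUP x. g x)" using that pos by (simp flip: b_def)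
        then obtain x where "t * b < g x" using less_cSUP_iff[OF UNIV_not_empty bdd(2)] by blast
        then have "t < g x / b" using pos by (simp add: pos_less_divide_eq)
        then show ?thesis ..
      qed
      fix x y
      have "(f x / a) powr l * (g y / b) powr (1 - l) = f x powr l * g y powr (1 - l) / c"
        using f g pos by (simp add: powr_divide c_def)
      also have "\<dots> \<le> h (l * x + (1 - l) * y) / c"
        using c fgh by (intro divide_right_mono) auto
      finally show "(f x / a) powr l * (g y / b) powr (1 - l) \<le> h (l * x + (1 - l) * y) / c" .
    qed (use f g h pos c l fa gb in \<open>simp_all add: divide_le_eq\<close>)
    have conv: "(\<integral>\<^sup>+x. ennreal (k x / d) \<partial>lborel) = ennreal ((\<integral>x. k x \<partial>lborel) / d)"
      if "integrable lborel k" "\<And>x. 0 \<le> k x" "d > 0" for k :: "real \<Rightarrow> real" and d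
      using that by (subst nn_integral_eq_integral) auto
    have conv_f: "(\<integral>\<^sup>+x. ennreal (f x / a) \<partial>lborel) = ennreal ((\<integral>x. f x \<partial>lborel) / a)"
      by (rule conv[OF int[OF assms(1), where D=C] _ pos(1)]) (use f in auto)
    have conv_g: "(\<integral>\<^sup>+x. ennreal (g x / b) \<partial>lborel) = ennreal ((\<integral>x. g x \<partial>lborel) / b)"
      by (rule conv[OF int[OF assms(2), where D=C] _ pos(2)]) (use g in auto)
    have conv_h: "(\<integral>\<^sup>+x. ennreal (h x / c) \<partial>lborel) = ennreal ((\<integral>x. h x \<partial>lborel) / c)"
      by (rule conv[OF int[OF assms(3), where D=C] _ c]) (use h in auto)
    have "0 \<le> (\<integral>x. f x \<partial>lborel) / a" "0 \<le> (\<integral>x. g x \<partial>lborel) / b"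
      using f g pos by auto
    then have "ennreal (l * ((\<integral>x. f x \<partial>lborel) / a) + (1 - l) * ((\<integral>x. g x \<partial>lborel) / b))
      = ennreal l * ennreal ((\<integral>x. f x \<partial>lborel) / a) + ennreal (1 - l) * ennreal ((\<integral>x. g x \<partial>lborel) / b)"
      using l by (simp add: ennreal_mult' del: times_divide_eq_right)
    also have "\<dots> \<le> ennreal ((\<integral>x. h x \<partial>lborel) / c)"
      using ineq unfolding conv_f conv_g conv_h .
    finally have "ennreal (l * ((\<integral>x. f x \<partial>lborel) / a) + (1 - l) * ((\<integral>x. g x \<partial>lborel) / b))
      \<le> ennreal ((\<integral>x. h x \<partial>lborel) / c)" .
    then have "l * ((\<integral>x. f x \<partial>lborel) / a) + (1 - l) * ((\<integral>x. g x \<partial>lborel) / b) \<le> (\<integral>x. h x \<partial>lborel) / c"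
      using h0 c by (subst (asm) ennreal_le_iff) auto
    moreover have "((\<integral>x. f x \<partial>lborel) / a) powr l * ((\<integral>x. g x \<partial>lborel) / b) powr (1 - l)
       \<le> l * ((\<integral>x. f x \<partial>lborel) / a) + (1 - l) * ((\<integral>x. g x \<partial>lborel) / b)"
      using l f g pos by (intro weighted_AM_GM) auto
    moreover have "((\<integral>x. f x \<partial>lborel) / a) powr l * ((\<integral>x. g x \<partial>lborel) / b) powr (1 - l)
       = (\<integral>x. f x \<partial>lborel) powr l * (\<integral>x. g x \<partial>lborel) powr (1 - l) / c"
      using f g pos by (simp add: powr_divide c_def)
    ultimately have "(\<integral>x. f x \<partial>lborel) powr l * (\<integral>x. g x \<partial>lborel) powr (1 - l) / c \<le> (\<integral>x. h x \<partial>lborel) / c"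
      by linarith
    then show ?thesis using c by (simp add: divide_le_cancel)
  qed
qed

text \<open>Bounded, nonnegative and supported in a cube. This class is closed under integrating out one
  coordinate and keeps all integrals finite, which makes the induction on the dimension run with
  real-valued integrals.\<close>

definition boxed :: "'i set \<Rightarrow> real \<Rightarrow> real \<Rightarrow> (('i \<Rightarrow> real) \<Rightarrow> real) \<Rightarrow> bool" where
  "boxed I R C f \<longleftrightarrow> f \<in> borel_measurable (\<Pi>\<^sub>M i\<in>I. lborel) \<and>
     (\<forall>x\<in>space (\<Pi>\<^sub>M i\<in>I. lborel :: real measure). 0 \<le> f x \<and> f x \<le> C \<and> (f x \<noteq> 0 \<longrightarrow> (\<forall>i\<in>I. \<bar>x i\<bar> \<le> R)))"

lemma boxed_integrable:
  assumes "finite I" "boxed I R C f"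
  shows "integrable (\<Pi>\<^sub>M i\<in>I. lborel) f"
proof -
  interpret product_sigma_finite "\<lambda>_. lborel :: real measure" by standard
  show ?thesis
  proof (rule integrableI_bounded_set[where A="Pi\<^sub>E I (\<lambda>_. {-R..R})" and B=C])
    show "AE x\<in>Pi\<^sub>E I (\<lambda>_. {-R..R}) in \<Pi>\<^sub>M i\<in>I. lborel. norm (f x) \<le> C"
      using assms by (intro AE_I2) (auto simp: boxed_def)
    show "AE x in \<Pi>\<^sub>M i\<in>I. lborel. x \<notin> Pi\<^sub>E I (\<lambda>_. {-R..R}) \<longrightarrow> f x = 0"
    proof (rule AE_I2, rule impI, rule ccontr)
      fix x assume x: "x \<in> space (\<Pi>\<^sub>M i\<in>I. lborel :: real measure)" "x \<notin> Pi\<^sub>E I (\<lambda>_. {-R..R})" "f x \<noteq> 0"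
      then have "\<forall>i\<in>I. \<bar>x i\<bar> \<le> R" using assms unfolding boxed_def by blast
      then have "x \<in> Pi\<^sub>E I (\<lambda>_. {-R..R})" using x(1) by (auto simp: space_PiM PiE_iff abs_le_iff minus_le_iff)
      with x(2) show False by simp
    qed
    show "emeasure (\<Pi>\<^sub>M i\<in>I. lborel) (Pi\<^sub>E I (\<lambda>_. {-R..R})) < \<infinity>"
      using assms by (simp add: emeasure_PiM emeasure_lborel_Icc_eq power_eq_top_ennreal less_top[symmetric])
    show "Pi\<^sub>E I (\<lambda>_. {-R..R}) \<in> sets (\<Pi>\<^sub>M i\<in>I. lborel :: real measure)" 
      using assms by (auto intro!: sets_PiM_I_finite)
  qed (use assms in \<open>auto simp: boxed_def\<close>)
qed

lemma boxed_marginal: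
  assumes "finite I" "i \<notin> I" "R \<ge> 0" and f: "boxed (insert i I) R C f"
  shows "boxed I R (C * (2 * R)) (\<lambda>x. \<integral>y. f (x(i := y)) \<partial>lborel)"
    and "\<And>x. x \<in> space (\<Pi>\<^sub>M i\<in>I. lborel) \<Longrightarrow> (\<lambda>y. f (x(i := y))) \<in> borel_measurable borel"
    and "\<And>x y. x \<in> space (\<Pi>\<^sub>M i\<in>I. lborel) \<Longrightarrow>
      0 \<le> f (x(i := y)) \<and> f (x(i := y)) \<le> C \<and> (f (x(i := y)) \<noteq> 0 \<longrightarrow> \<bar>y\<bar> \<le> R)"
proof -
  have sp: "x(i := y) \<in> space (\<Pi>\<^sub>M i\<in>insert i I. lborel :: real measure)"
    if "x \<in> space (\<Pi>\<^sub>M i\<in>I. lborel)" for x and y :: real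
    using that by (auto simp: space_PiM PiE_iff extensional_def)
  have [measurable]: "f \<in> borel_measurable (\<Pi>\<^sub>M i\<in>insert i I. lborel)" using f by (auto simp: boxed_def)
  have m2: "(\<lambda>(x, y). f (x(i := y))) \<in> borel_measurable ((\<Pi>\<^sub>M i\<in>I. lborel) \<Otimes>\<^sub>M (lborel :: real measure))"
    using measurable_compose[OF measurable_add_dim[of i I "\<lambda>_. lborel :: real measure"], of f borel]
    by (simp add: case_prod_unfold)
  show "(\<lambda>y. f (x(i := y))) \<in> borel_measurable borel" if "x \<in> space (\<Pi>\<^sub>M i\<in>I. lborel)" for x
    using measurable_compose[OF measurable_Pair1'[OF that, of lborel] m2] by simp
  show b: "0 \<le> f (x(i := y)) \<and> f (x(i := y)) \<le> C \<and> (f (x(i := y)) \<noteq> 0 \<longrightarrow> \<bar>y\<bar> \<le> R)"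
    if "x \<in> space (\<Pi>\<^sub>M i\<in>I. lborel)" for x y
    using f sp[OF that, of y] unfolding boxed_def by (metis fun_upd_same insertI1)
  have m3: "(\<lambda>x. \<integral>y. f (x(i := y)) \<partial>lborel) \<in> borel_measurable (\<Pi>\<^sub>M i\<in>I. lborel)"
    using m2 by measurable
  show "boxed I R (C * (2 * R)) (\<lambda>x. \<integral>y. f (x(i := y)) \<partial>lborel)"
    unfolding boxed_def
  proof (intro conjI ballI impI m3)
    fix x assume x: "x \<in> space (\<Pi>\<^sub>M i\<in>I. lborel :: real measure)"
    show "0 \<le> (\<integral>y. f (x(i := y)) \<partial>lborel)" using b[OF x] by (intro integral_nonneg_AE) auto
    have C: "C \<ge> 0" using b[OF x, of 0] by linarith
    have "(\<integral>y. f (x(i := y)) \<partial>lborel) \<le> (\<integral>y. C * indicator {-R..R} y \<partial>lborel)"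
    proof (rule integral_mono')
      show "integrable lborel (\<lambda>y. C * indicator {-R..R} y)" 
        by (simp add: emeasure_lborel_Icc_eq)
      show "f (x(i := y)) \<le> C * indicator {-R..R} y" for y
        using b[OF x, of y] by (cases "y \<in> {-R..R}") (auto simp: abs_le_iff)
    qed (use C in auto)
    also have "\<dots> = C * (2 * R)" using \<open>R \<ge> 0\<close> by simp
    finally show "(\<integral>y. f (x(i := y)) \<partial>lborel) \<le> C * (2 * R)" .
    fix j assume nz: "(\<integral>y. f (x(i := y)) \<partial>lborel) \<noteq> 0" and j: "j \<in> I"
    have "\<exists>y. f (x(i := y)) \<noteq> 0"
    proof (rule ccontr)
      assume "\<nexists>y. f (x(i := y)) \<noteq> 0"
      then show False using nz by simp
    qed
    then obtain y where "f (x(i := y)) \<noteq> 0" ..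
    then have "\<forall>k\<in>insert i I. \<bar>(x(i := y)) k\<bar> \<le> R"
      using f sp[OF x, of y] unfolding boxed_def by blast
    then show "\<bar>x j\<bar> \<le> R" using j \<open>i \<notin> I\<close> by (metis fun_upd_other insertI2)
  qed
qed

text \<open>Induction on the number of coordinates: for fixed values of the other coordinates the
  one-dimensional inequality is the hypothesis for the marginals, to which the induction hypothesis
  applies.\<close>

lemma Prekopa_Leindler_PiM:
  assumes "finite I" "R \<ge> 0" "boxed I R C f" "boxed I R C g" "boxed I R C h" "0 < l" "l < 1"
    and "\<And>x y. x \<in> space (\<Pi>\<^sub>M i\<in>I. lborel) \<Longrightarrow> y \<in> space (\<Pi>\<^sub>M i\<in>I. lborel) \<Longrightarrow>
       f x powr l * g y powr (1 - l) \<le> h (\<lambda>i\<in>I. l * x i + (1 - l) * y i)"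
  shows "(\<integral>x. f x \<partial>(\<Pi>\<^sub>M i\<in>I. lborel)) powr l * (\<integral>x. g x \<partial>(\<Pi>\<^sub>M i\<in>I. lborel)) powr (1 - l)
    \<le> (\<integral>x. h x \<partial>(\<Pi>\<^sub>M i\<in>I. lborel))"
  using assms(1,3,4,5,8)
proof (induction I arbitrary: f g h C)
  case empty
  interpret product_sigma_finite "\<lambda>_. lborel :: real measure" by standard
  show ?case using empty(4)[of "\<lambda>_. undefined" "\<lambda>_. undefined"] 
    by (simp add: PiM_empty lebesgue_integral_count_space_finite restrict_def)
next
  case (insert i I f g h C)
  interpret product_sigma_finite "\<lambda>_. lborel :: real measure" by standard
  let ?m = "\<lambda>f x. \<integral>y. f (x(i := y)) \<partial>(lborel :: real measure)"
  note bm = boxed_marginal[OF insert(1,2) assms(2)]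
  have red: "(\<integral>x. f x \<partial>(\<Pi>\<^sub>M i\<in>insert i I. lborel)) = (\<integral>x. ?m f x \<partial>(\<Pi>\<^sub>M i\<in>I. lborel))"
    if "boxed (insert i I) R C f" for f
    using product_integral_insert[OF insert(1,2), of f] boxed_integrable[OF _ that] insert by simp
  show ?case
    unfolding red[OF insert(4)] red[OF insert(5)] red[OF insert(6)]
  proof (rule insert(3)[OF bm(1)[OF insert(4)] bm(1)[OF insert(5)] bm(1)[OF insert(6)]])
    fix x x' assume x: "x \<in> space (\<Pi>\<^sub>M i\<in>I. lborel :: real measure)" and x': "x' \<in> space (\<Pi>\<^sub>M i\<in>I. lborel :: real measure)"
    let ?z = "\<lambda>i\<in>I. l * x i + (1 - l) * x' i"
    have z: "?z \<in> space (\<Pi>\<^sub>M i\<in>I. lborel)" by (auto simp: space_PiM)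
    note F = bm(2,3)[OF insert(4) x] and G = bm(2,3)[OF insert(5) x'] and H = bm(2,3)[OF insert(6) z]
    show "?m f x powr l * ?m g x' powr (1 - l) \<le> ?m h ?z"
    proof (rule Prekopa_Leindler_real[where C=C and R=R])
      fix a b :: real
      have "f (x(i := a)) powr l * g (x'(i := b)) powr (1 - l)
         \<le> h (\<lambda>j\<in>insert i I. l * (x(i := a)) j + (1 - l) * (x'(i := b)) j)"
        using x x' by (intro insert(7)) (auto simp: space_PiM PiE_iff extensional_def)
      also have "(\<lambda>j\<in>insert i I. l * (x(i := a)) j + (1 - l) * (x'(i := b)) j) = ?z(i := l * a + (1 - l) * b)"
        using insert(2) by (auto simp: fun_eq_iff)
      finally show "f (x(i := a)) powr l * g (x'(i := b)) powr (1 - l) \<le> h (?z(i := l * a + (1 - l) * b))" .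
    qed (use F G H assms in blast)+
  qed
qed

text \<open>The Prekopa--Leindler inequality for the indicator functions of the three sets.\<close>

theorem Brunn_Minkowski_multiplicative:
  fixes A B C :: "'a::euclidean_space set"
  assumes "compact A" "compact B" "compact C" "0 < l" "l < 1"
    and C: "\<And>x y. x \<in> A \<Longrightarrow> y \<in> B \<Longrightarrow> l *\<^sub>R x + (1 - l) *\<^sub>R y \<in> C"
  shows "measure lborel A powr l * measure lborel B powr (1 - l) \<le> measure lborel C"
proof -
  define T :: "('a \<Rightarrow> real) \<Rightarrow> 'a" where "T = (\<lambda>x. \<Sum>b\<in>Basis. x b *\<^sub>R b)"
  have T[measurable]: "T \<in> (\<Pi>\<^sub>M b\<in>Basis. lborel) \<rightarrow>\<^sub>M borel" unfolding T_def by measurable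
  have meas: "measure lborel S = (\<integral>x. indicator S (T x) \<partial>(\<Pi>\<^sub>M b\<in>Basis. lborel))" if "compact S" for S :: "'a set"
  proof -
    have [measurable]: "S \<in> sets borel" using that by (rule borel_compact)
    have "measure lborel S = (\<integral>x. indicator S x \<partial>lborel)" by simp
    also have "\<dots> = (\<integral>x. indicator S x \<partial>distr (\<Pi>\<^sub>M b\<in>Basis. lborel) borel T)"
      unfolding T_def by (subst lborel_eq) simp
    also have "\<dots> = (\<integral>x. indicator S (T x) \<partial>(\<Pi>\<^sub>M b\<in>Basis. lborel))"
      by (rule integral_distr) (use T in auto)
    finally show ?thesis .
  qed
  have "bounded (A \<union> B \<union> C)" using assms by (auto intro: compact_imp_bounded)
  then obtain R where R: "R > 0" "\<And>x. x \<in> A \<union> B \<union> C \<Longrightarrow> norm x \<le> R"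
    by (meson bounded_pos)
  have box: "boxed Basis R 1 (\<lambda>x. indicator S (T x))" if "compact S" "S \<subseteq> A \<union> B \<union> C" for S
  proof -
    have [measurable]: "S \<in> sets borel" using that by (auto intro: borel_compact)
    have "\<bar>x b\<bar> \<le> R" if "T x \<in> S" "b \<in> Basis" for x b
    proof -
      have "x b = T x \<bullet> b"
        using that by (simp add: T_def inner_sum_left inner_Basis if_distrib cong: if_cong)
      then show ?thesis using Basis_le_norm[OF that(2), of "T x"] R(2)[of "T x"] that \<open>S \<subseteq> _\<close> by auto
    qed
    then show ?thesis unfolding boxed_def by (auto simp: indicator_def)
  qed
  have "(\<integral>x. indicator A (T x) \<partial>(\<Pi>\<^sub>M b\<in>Basis. lborel)) powr l *
     (\<integral>x. indicator B (T x) \<partial>(\<Pi>\<^sub>M b\<in>Basis. lborel)) powr (1 - l)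
     \<le> (\<integral>x. indicator C (T x) \<partial>(\<Pi>\<^sub>M b\<in>Basis. lborel))"
  proof (rule Prekopa_Leindler_PiM[where R=R and C=1])
    fix x y :: "'a \<Rightarrow> real"
    have "T (\<lambda>i\<in>Basis. l * x i + (1 - l) * y i) = l *\<^sub>R T x + (1 - l) *\<^sub>R T y"
      by (simp add: T_def scaleR_left_distrib sum.distrib scaleR_sum_right)
    then show "indicator A (T x) powr l * indicator B (T y) powr (1 - l)
       \<le> (indicator C (T (\<lambda>i\<in>Basis. l * x i + (1 - l) * y i)) :: real)"
      using C[of "T x" "T y"] by (auto simp: indicator_def)
  qed (use assms R box in auto)
  then show ?thesis using assms by (simp add: meas)
qed

section \<open>Convex bodies and their support functions\<close>

text \<open>A point of \<open>M\<close> outside the closed set \<open>N\<close> is a limit of interior points of \<open>M\<close>, so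
  \<open>M - N\<close> contains a nonempty open set and has positive measure.\<close>

lemma convex_body_eq_if_measure_le:
  fixes M N :: "'a::euclidean_space set"
  assumes M: "compact M" "convex M" "interior M \<noteq> {}" and N: "compact N" "N \<subseteq> M"
    and le: "measure lborel M \<le> measure lborel N"
  shows "M = N"
proof (rule ccontr)
  assume "M \<noteq> N"
  then obtain y where y: "y \<in> M" "y \<notin> N" using N by blast
  \<comment> \<open>\<open>V\<close> is open and nonempty, which contradicts the inequality of the measures.\<close>
  define V where "V = interior M \<inter> - N"
  have "closure (interior M) = M"
    using M by (simp add: convex_closure_interior compact_imp_closed)
  then have "V \<noteq> {}"
    using y N open_Int_closure_eq_empty[of "- N" "interior M"] compact_imp_closed[OF N(1)]
    unfolding V_def by (auto simp: open_Compl Int_commute)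
  have "open V" using N unfolding V_def by (auto intro!: compact_imp_closed)
  have "bounded V"
    unfolding V_def using M compact_imp_bounded bounded_subset interior_subset
    by (metis Int_lower1)
  have Vl: "V \<in> lmeasurable" using \<open>open V\<close> \<open>bounded V\<close> by (rule lmeasurable_open[rotated])
  have "\<not> negligible V" using \<open>open V\<close> \<open>V \<noteq> {}\<close> by (rule open_not_negligible)
  then have pos: "measure lebesgue V > 0"
    using negligible_iff_measure0[OF Vl] measure_nonneg[of lebesgue V] by linarith
  have Nl: "N \<in> lmeasurable" and Ml: "M \<in> lmeasurable"
    using M N by (auto intro: lmeasurable_compact)
  have "measure lebesgue (N \<union> V) = measure lebesgue N + measure lebesgue V"
    by (rule measure_Un_AE) (use Nl Vl V_def in auto)
  moreover have "measure lebesgue (N \<union> V) \<le> measure lebesgue M"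
    using Nl Vl Ml N(2) interior_subset[of M]
    by (intro measure_mono_fmeasurable) (auto simp: V_def)
  ultimately show False using pos le M N by (simp add: borel_compact)
qed

text \<open>Strict form of Bernoulli's inequality: the graph of \<open>t powr p\<close> lies above its tangent at 1. It
  supplies the equality case of the power mean inequality.\<close>

lemma powr_tangent_less:
  fixes t p :: real
  assumes "0 < t" "t \<noteq> 1" "1 < p"
  shows "1 + p * (t - 1) < t powr p"
proof -
  have D: "((\<lambda>x. x powr p) has_real_derivative p * z powr (p - 1)) (at z)" if "z > 0" for z
    using that by (auto intro!: derivative_eq_intros simp: powr_diff)
  show ?thesis
  proof (cases "t > 1")
    case True
    obtain z where z: "1 < z" "z < t" "t powr p - 1 powr p = (t - 1) * (p * z powr (p - 1))"
      using MVT2[of 1 t "\<lambda>x. x powr p" "\<lambda>z. p * z powr (p - 1)"] True D by auto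
    have "1 < z powr (p - 1)" using z assms by simp
    then have "(t - 1) * (p * 1) < (t - 1) * (p * z powr (p - 1))"
      using True assms by (intro mult_strict_left_mono) auto
    then show ?thesis using z by (simp add: algebra_simps)
  next
    case False
    obtain z where z: "t < z" "z < 1" "1 powr p - t powr p = (1 - t) * (p * z powr (p - 1))"
      using MVT2[of t 1 "\<lambda>x. x powr p" "\<lambda>z. p * z powr (p - 1)"] False assms D by auto
    have "z powr (p - 1) < 1" using powr_less_mono2[of "p - 1" z 1] z assms by simp
    then have "(1 - t) * (p * z powr (p - 1)) < (1 - t) * (p * 1)"
      using False assms by (intro mult_strict_left_mono) auto
    then show ?thesis using z by (simp add: algebra_simps)
  qed
qed

lemma powr_convex_less:
  fixes a b l p :: real
  assumes "0 < a" "0 < b" "0 < l" "l < 1" "1 < p" "a \<noteq> b"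
  shows "(l * a + (1 - l) * b) powr p < l * a powr p + (1 - l) * b powr p"
proof -
  define c where "c = l * a + (1 - l) * b"
  have c: "c > 0" unfolding c_def using assms by (intro add_pos_pos mult_pos_pos) auto
  have "c - a = (1 - l) * (b - a)" "c - b = l * (a - b)" unfolding c_def by (simp_all only: algebra_simps)
  moreover have "(1 - l) * (b - a) \<noteq> 0" "l * (a - b) \<noteq> 0" using assms(3,4,6) by simp_all
  ultimately have "c - a \<noteq> 0" "c - b \<noteq> 0" by metis+
  then have ne: "a / c \<noteq> 1" "b / c \<noteq> 1" using c by simp_all
  have tan: "c powr p + p * (x - c) * c powr (p - 1) < x powr p" if "x > 0" "x / c \<noteq> 1" for x
  proof -
    have "(1 + p * (x / c - 1)) * c powr p < (x / c) powr p * c powr p"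
      using powr_tangent_less[of "x / c" p] that c assms by simp
    moreover have "(x / c) powr p * c powr p = x powr p"
      using that c by (simp add: powr_divide)
    moreover have "(1 + p * (x / c - 1)) * c powr p = c powr p + p * ((x / c - 1) * c) * c powr (p - 1)"
      using c by (simp add: powr_diff algebra_simps)
    moreover have "(x / c - 1) * c = x - c" using c by (simp add: left_diff_distrib)
    ultimately show ?thesis by simp
  qed
  have "l * (c powr p + p * (a - c) * c powr (p - 1)) + (1 - l) * (c powr p + p * (b - c) * c powr (p - 1))
     < l * a powr p + (1 - l) * b powr p"
    using tan[of a] tan[of b] ne assms by (intro add_strict_mono mult_strict_left_mono) auto
  moreover have "l * (c powr p + p * (a - c) * c powr (p - 1)) + (1 - l) * (c powr p + p * (b - c) * c powr (p - 1))
     = c powr p + p * c powr (p - 1) * (l * a + (1 - l) * b - c)"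
    by (simp add: algebra_simps)
  ultimately show ?thesis by (simp add: c_def)
qed

lemma powr_convex_le:
  fixes a b l p :: real
  assumes "0 < a" "0 < b" "0 < l" "l < 1" "1 < p"
  shows "(l * a + (1 - l) * b) powr p \<le> l * a powr p + (1 - l) * b powr p"
  using powr_convex_less[of a b l p] assms by (cases "a = b") (auto simp: algebra_simps)

lemma inner_le_support_fun:
  assumes "compact K" "y \<in> K"
  shows "x \<bullet> y \<le> support_fun K x"
  unfolding support_fun_def
  using assms by (intro cSUP_upper) (auto intro!: bounded_imp_bdd_above compact_imp_bounded compact_continuous_image continuous_intros)

lemma support_fun_attained:
  assumes "compact K" "K \<noteq> {}"
  obtains y where "y \<in> K" "support_fun K x = x \<bullet> y"
proof -
  have "continuous_on K (\<lambda>y. x \<bullet> y)" by (intro continuous_intros)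
  then obtain y where y: "y \<in> K" "\<And>z. z \<in> K \<Longrightarrow> x \<bullet> z \<le> x \<bullet> y"
    using continuous_attains_sup[OF assms] by blast
  then have "support_fun K x = x \<bullet> y"
    using inner_le_support_fun[OF assms(1) y(1)] assms
    unfolding support_fun_def by (intro antisym cSUP_least) auto
  with y show ?thesis using that by blast
qed

lemma support_fun_pos:
  assumes "compact K" "0 \<in> interior K" "x \<noteq> 0"
  shows "0 < support_fun K x"
proof -
  obtain e where e: "e > 0" "cball 0 e \<subseteq> K"
    using assms(2) by (meson mem_interior_cball)
  have "(e / norm x) *\<^sub>R x \<in> K" using e assms by (intro subsetD[OF e(2)]) auto
  from inner_le_support_fun[OF assms(1) this, of x]
  have "x \<bullet> ((e / norm x) *\<^sub>R x) \<le> support_fun K x" .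
  moreover have "x \<bullet> ((e / norm x) *\<^sub>R x) > 0" using e assms by (simp add: inner_gt_zero_iff)
  ultimately show ?thesis by linarith
qed

lemma mem_if_inner_le_support_fun:
  fixes N :: "'a::euclidean_space set"
  assumes "compact N" "convex N" "N \<noteq> {}" and le: "\<And>u. u \<in> sphere 0 1 \<Longrightarrow> u \<bullet> z \<le> support_fun N u"
  shows "z \<in> N"
proof (rule ccontr)
  assume "z \<notin> N"
  then obtain a b where ab: "a \<bullet> z < b" "\<And>x. x \<in> N \<Longrightarrow> b < a \<bullet> x"
    using separating_hyperplane_closed_point[of N z] assms compact_imp_closed by blast
  obtain n where "n \<in> N" using assms by blast
  have "a \<noteq> 0" using ab(1) ab(2)[OF \<open>n \<in> N\<close>] by auto
  \<comment> \<open>The outer unit normal of a hyperplane that separates \<open>z\<close> from \<open>N\<close>.\<close>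
  define u where "u = - (a /\<^sub>R norm a)"
  have u: "u \<in> sphere 0 1" using \<open>a \<noteq> 0\<close> by (simp add: u_def)
  obtain y where y: "y \<in> N" "support_fun N u = u \<bullet> y"
    using support_fun_attained assms by metis
  have "u \<bullet> y < u \<bullet> z"
    using ab(1) ab(2)[OF y(1)] \<open>a \<noteq> 0\<close> by (simp add: u_def divide_strict_right_mono divide_inverse_commute[symmetric])
  then show False using le[OF u] y by simp
qed

text \<open>The property that characterises \<^const>\<open>body_of_support_powr\<close>, as a predicate that can be
  established for explicitly constructed bodies.\<close>

definition has_support_powr :: "real \<Rightarrow> ('a::euclidean_space \<Rightarrow> real) \<Rightarrow> 'a set \<Rightarrow> bool" where
  "has_support_powr p f K \<longleftrightarrow> compact K \<and> convex K \<and> 0 \<in> interior K \<and>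
     (\<forall>u\<in>sphere 0 1. support_fun K u powr p = f u)"

lemma has_support_powr_subset:
  assumes "has_support_powr p f K" "has_support_powr p f K'" "p > 0"
  shows "K \<subseteq> K'"
proof
  fix z assume z: "z \<in> K"
  note K = assms(1,2)[unfolded has_support_powr_def]
  show "z \<in> K'"
  proof (rule mem_if_inner_le_support_fun)
    fix u :: 'a assume u: "u \<in> sphere 0 1"
    then have "u \<noteq> 0" by auto
    then have "support_fun K u = support_fun K' u"
      using K u support_fun_pos[of K u] support_fun_pos[of K' u] \<open>p > 0\<close>
      by (metis less_irrefl linorder_neqE_linordered_idom order.strict_implies_order powr_less_mono2)
    then show "u \<bullet> z \<le> support_fun K' u" using inner_le_support_fun[of K z u] K z by simp
  qed (use K interior_subset in auto)
qed

lemma body_of_support_powr_eq: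
  assumes "has_support_powr p f K" "p > 0"
  shows "body_of_support_powr p f = K"
  unfolding body_of_support_powr_def
proof (rule the_equality)
  show "compact K \<and> convex K \<and> 0 \<in> interior K \<and> (\<forall>u\<in>sphere 0 1. support_fun K u powr p = f u)"
    using assms by (simp add: has_support_powr_def)
next
  fix K' assume "compact K' \<and> convex K' \<and> 0 \<in> interior K' \<and> (\<forall>u\<in>sphere 0 1. support_fun K' u powr p = f u)"
  then have "has_support_powr p f K'" by (simp add: has_support_powr_def)
  then show "K' = K" using has_support_powr_subset assms by blast
qed

lemma support_fun_uminus: "support_fun (uminus ` K) u = support_fun K (- u)"
  unfolding support_fun_def by (simp add: image_image)

lemma has_support_powr_uminus:
  assumes "has_support_powr p f K"
  shows "has_support_powr p (\<lambda>u. f (- u)) (uminus ` K)"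
proof -
  have "0 \<in> interior (uminus ` K)"
    using assms by (simp add: has_support_powr_def interior_negations)
  then show ?thesis using assms
    unfolding has_support_powr_def
    by (auto simp: compact_negations convex_negations support_fun_uminus)
qed

lemma measure_uminus_compact:
  assumes "compact K"
  shows "measure lborel (uminus ` K) = measure lborel (K :: 'a::euclidean_space set)"
proof -
  have "measure lebesgue ((\<lambda>x. (-1) *\<^sub>R x + 0) ` K) = measure lebesgue K"
    by (subst measure_lebesgue_affine) simp
  then have "measure lebesgue (uminus ` K) = measure lebesgue K" by simp
  then show ?thesis using assms compact_negations[OF assms] by (simp add: borel_compact)
qed

section \<open>Volume of the combination of a body with its reflection\<close>

text \<open>The support function of the \<open>L\<^sub>p\<close> combination is the \<open>p\<close>-th power mean of the two support
  functions, and that of the Minkowski combination is their arithmetic mean, which is smaller.\<close>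

lemma Firey_sum_contains_Minkowski_sum:
  fixes K K' M :: "'a::euclidean_space set"
  assumes K: "has_support_powr p f K" and K': "has_support_powr p f' K'"
    and M: "has_support_powr p (\<lambda>u. l * f u + (1 - l) * f' u) M"
    and "1 < p" "0 < l" "l < 1" "x \<in> K" "y \<in> K'"
  shows "l *\<^sub>R x + (1 - l) *\<^sub>R y \<in> M"
proof (rule mem_if_inner_le_support_fun)
  note D = K[unfolded has_support_powr_def] K'[unfolded has_support_powr_def] M[unfolded has_support_powr_def]
  fix u :: 'a assume u: "u \<in> sphere 0 1"
  then have "u \<noteq> 0" by auto
  then have pos: "0 < support_fun K u" "0 < support_fun K' u" "0 < support_fun M u"
    using D by (auto intro: support_fun_pos)
  have "(l * support_fun K u + (1 - l) * support_fun K' u) powr p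
    \<le> l * support_fun K u powr p + (1 - l) * support_fun K' u powr p"
    using pos assms by (intro powr_convex_le) auto
  also have "\<dots> = support_fun M u powr p" using D u by simp
  finally have "l * support_fun K u + (1 - l) * support_fun K' u \<le> support_fun M u"
    using pos \<open>1 < p\<close> by (meson less_imp_le not_le powr_less_mono2 less_trans zero_less_one)
  moreover have "l * (u \<bullet> x) \<le> l * support_fun K u" "(1 - l) * (u \<bullet> y) \<le> (1 - l) * support_fun K' u"
    using D assms by (auto intro!: mult_left_mono inner_le_support_fun)
  ultimately show "u \<bullet> (l *\<^sub>R x + (1 - l) *\<^sub>R y) \<le> support_fun M u"
    by (simp add: inner_add_right)
qed (use M interior_subset in \<open>auto simp: has_support_powr_def\<close>)

text \<open>\<open>M\<close> is the \<open>L\<^sub>p\<close> combination of \<open>K\<close> and \<open>- K\<close>. It contains the Minkowski combination \<open>N\<close>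
  of these bodies, whose volume is at least that of \<open>K\<close> by Brunn--Minkowski since \<open>K\<close> and \<open>- K\<close>
  have equal volume. If \<open>M\<close> and \<open>K\<close> have equal volume, then \<open>M = N\<close>, so the power mean and the
  arithmetic mean of the two support functions agree in every direction, which forces the two values
  to coincide.\<close>

theorem volume_Firey_symmetrization:
  fixes K M :: "'a::euclidean_space set"
  assumes K: "has_support_powr p f K"
    and M: "has_support_powr p (\<lambda>u. l * f u + (1 - l) * f (- u)) M"
    and "1 < p" "0 < l" "l < 1"
  shows "measure lborel K \<le> measure lborel M"
    and "measure lborel M = measure lborel K \<Longrightarrow> u \<in> sphere 0 1 \<Longrightarrow> f (- u) = f u"
proof -
  note K' = has_support_powr_uminus[OF K]
  note D = K[unfolded has_support_powr_def] K'[unfolded has_support_powr_def] M[unfolded has_support_powr_def]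
  define N where "N = {l *\<^sub>R x + (1 - l) *\<^sub>R y | x y. x \<in> K \<and> y \<in> uminus ` K}"
  have NM: "N \<subseteq> M"
    unfolding N_def using Firey_sum_contains_Minkowski_sum[OF K K' M] assms by auto
  have "N = (\<lambda>z. l *\<^sub>R fst z + (1 - l) *\<^sub>R snd z) ` (K \<times> uminus ` K)"
    unfolding N_def by force
  moreover have "compact (K \<times> uminus ` K)" using D by (intro compact_Times) auto
  ultimately have N: "compact N"
    by (simp only:) (intro compact_continuous_image continuous_intros)
  have "measure lborel K powr l * measure lborel (uminus ` K) powr (1 - l) \<le> measure lborel N"
    using D N assms by (intro Brunn_Minkowski_multiplicative) (auto simp: N_def)
  moreover have "measure lborel K powr l * measure lborel K powr (1 - l) = measure lborel K"
    by (simp flip: powr_add)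
  ultimately have KN: "measure lborel K \<le> measure lborel N"
    using D by (simp add: measure_uminus_compact)
  have NM': "measure lborel N \<le> measure lborel M"
    using N D NM by (intro measure_mono_fmeasurable)
      (auto intro!: fmeasurableI emeasure_bounded_finite compact_imp_bounded borel_compact)
  show "measure lborel K \<le> measure lborel M" using KN NM' by linarith
  assume eq: "measure lborel M = measure lborel K" and u: "u \<in> sphere 0 1"
  have MN: "M = N" using D N NM eq KN by (intro convex_body_eq_if_measure_le) auto
  have "u \<noteq> 0" "- u \<noteq> 0" using u by auto
  then have pos: "0 < support_fun K u" "0 < support_fun K (- u)"
    using D by (auto intro: support_fun_pos)
  obtain z where z: "z \<in> M" "support_fun M u = u \<bullet> z"
    using support_fun_attained[of M u] D interior_subset by blast
  then obtain x y where xy: "x \<in> K" "y \<in> uminus ` K" "z = l *\<^sub>R x + (1 - l) *\<^sub>R y"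
    unfolding MN N_def by auto
  have "l * (u \<bullet> x) \<le> l * support_fun K u" "(1 - l) * (u \<bullet> y) \<le> (1 - l) * support_fun (uminus ` K) u"
    using D assms xy by (auto intro!: mult_left_mono inner_le_support_fun)
  then have le: "support_fun M u \<le> l * support_fun K u + (1 - l) * support_fun K (- u)"
    using z xy by (simp add: inner_add_right support_fun_uminus)
  have "\<not> support_fun K u \<noteq> support_fun K (- u)"
  proof
    assume "support_fun K u \<noteq> support_fun K (- u)"
    then have "(l * support_fun K u + (1 - l) * support_fun K (- u)) powr p
      < l * support_fun K u powr p + (1 - l) * support_fun K (- u) powr p"
      using pos assms by (intro powr_convex_less) auto
    also have "\<dots> = support_fun M u powr p" using D u by simp
    also have "\<dots> \<le> (l * support_fun K u + (1 - l) * support_fun K (- u)) powr p"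
      using le D \<open>u \<noteq> 0\<close> \<open>1 < p\<close> by (intro powr_mono2) (auto intro: less_imp_le support_fun_pos)
    finally show False by simp
  qed
  then show "f (- u) = f u" using D u by (metis norm_minus_cancel mem_sphere_0)
qed

section \<open>Spherical Lebesgue measure\<close>

lemma space_spherical_measure [simp]: "space (spherical_measure :: 'a::euclidean_space measure) = sphere 0 1"
  by (simp add: spherical_measure_def space_scale_measure space_restrict_space)

lemma sets_spherical_measure [simp]:
  "sets (spherical_measure :: 'a::euclidean_space measure) = sets (restrict_space borel (sphere 0 1))"
  by (simp add: spherical_measure_def sets_scale_measure)

lemma measurable_sgn_sphere:
  "sgn \<in> restrict_space lborel (cball 0 1 - {0}) \<rightarrow>\<^sub>M restrict_space borel (sphere (0::'a::euclidean_space) 1)"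
proof (rule measurable_restrict_space2)
  show "sgn \<in> space (restrict_space lborel (cball 0 1 - {0})) \<rightarrow> sphere (0::'a) 1"
    by (auto simp: space_restrict_space norm_sgn)
  show "(sgn :: 'a \<Rightarrow> 'a) \<in> borel_measurable (restrict_space lborel (cball 0 1 - {0}))"
    unfolding sgn_div_norm by (rule measurable_restrict_space1) simp
qed

lemma cone_measurable:
  fixes A :: "'a::euclidean_space set"
  assumes "A \<in> sets (restrict_space borel (sphere 0 1))"
  shows "{x \<in> cball 0 1 - {0}. sgn x \<in> A} \<in> sets borel"
proof -
  have "sgn -` A \<inter> space (restrict_space lborel (cball (0::'a) 1 - {0})) \<in> sets (restrict_space lborel (cball 0 1 - {0}))"
    by (rule measurable_sets[OF measurable_sgn_sphere assms])
  moreover have "sgn -` A \<inter> space (restrict_space lborel (cball (0::'a) 1 - {0})) = {x \<in> cball 0 1 - {0}. sgn x \<in> A}"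
    by (auto simp: space_restrict_space)
  moreover have "cball (0::'a) 1 - {0} \<in> sets lborel" by simp
  ultimately show ?thesis by (simp add: sets_restrict_space_iff)
qed

text \<open>The spherical measure of a set is, up to the dimension factor, the volume of the punctured cone
  over it in the unit ball; all later facts about the measure are read off from this.\<close>

lemma emeasure_spherical_measure:
  fixes A :: "'a::euclidean_space set"
  assumes "A \<in> sets (restrict_space borel (sphere 0 1))"
  shows "emeasure spherical_measure A = of_nat DIM('a) * emeasure lborel {x \<in> cball 0 1 - {0}. sgn x \<in> A}"
proof -
  have "emeasure spherical_measure A
    = of_nat DIM('a) * emeasure (restrict_space lborel (cball 0 1 - {0}))
        (sgn -` A \<inter> space (restrict_space lborel (cball (0::'a) 1 - {0})))"
    unfolding spherical_measure_def
    by (simp add: emeasure_distr[OF measurable_sgn_sphere assms])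
  also have "sgn -` A \<inter> space (restrict_space lborel (cball (0::'a) 1 - {0})) = {x \<in> cball 0 1 - {0}. sgn x \<in> A}"
    by (auto simp: space_restrict_space)
  also have "emeasure (restrict_space lborel (cball 0 1 - {0})) {x \<in> cball 0 1 - {0}. sgn x \<in> A}
    = emeasure lborel {x \<in> cball 0 1 - {0}. sgn x \<in> A}"
    by (rule emeasure_restrict_space) auto
  finally show ?thesis .
qed

lemma finite_measure_spherical_measure: "finite_measure (spherical_measure :: 'a::euclidean_space measure)"
proof (rule finite_measureI)
  have "emeasure lborel {x \<in> cball 0 1 - {0 :: 'a}. sgn x \<in> sphere 0 1} \<le> emeasure lborel (cball (0::'a) 1)"
    by (rule emeasure_mono) auto
  also have "\<dots> < \<infinity>" by (rule emeasure_bounded_finite) simp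
  finally have fin: "emeasure lborel {x \<in> cball 0 1 - {0 :: 'a}. sgn x \<in> sphere 0 1} < \<infinity>" .
  have S: "sphere 0 1 \<in> sets (restrict_space borel (sphere (0::'a) 1))"
    using sets.top[of "restrict_space borel (sphere (0::'a) 1)"] by (simp add: space_restrict_space)
  show "emeasure (spherical_measure :: 'a measure) (space spherical_measure) \<noteq> \<infinity>"
    using fin by (simp add: emeasure_spherical_measure[OF S] ennreal_mult_eq_top_iff)
qed

lemma continuous_sphere_measurable:
  fixes g :: "'a::euclidean_space \<Rightarrow> 'b::topological_space"
  assumes "continuous_on (sphere 0 1) g"
  shows "g \<in> borel_measurable spherical_measure"
  using borel_measurable_continuous_on_restrict[OF assms]
  unfolding measurable_cong_sets[OF sets_spherical_measure refl] .

lemma continuous_sphere_integrable: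
  fixes g :: "'a::euclidean_space \<Rightarrow> 'b::{banach,second_countable_topology}"
  assumes "continuous_on (sphere 0 1) g"
  shows "integrable spherical_measure g"
proof -
  have "compact (g ` sphere 0 1)" by (rule compact_continuous_image[OF assms compact_sphere])
  then obtain B where "\<forall>y\<in>g ` sphere 0 1. norm y \<le> B"
    by (auto dest!: compact_imp_bounded simp: bounded_iff)
  then have "AE v in spherical_measure. norm (g v) \<le> B" by (intro AE_I2) simp
  then show ?thesis
    by (rule finite_measure.integrable_const_bound[OF finite_measure_spherical_measure])
      (rule continuous_sphere_measurable[OF assms])
qed

lemma uminus_measurable_spherical_measure:
  "uminus \<in> spherical_measure \<rightarrow>\<^sub>M (spherical_measure :: 'a::euclidean_space measure)"
proof -
  have "uminus \<in> restrict_space borel (sphere 0 1) \<rightarrow>\<^sub>M restrict_space borel (sphere (0::'a) 1)"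
    by (intro measurable_restrict_space2 measurable_restrict_space1)
      (auto simp: space_restrict_space)
  then show ?thesis by (simp cong: measurable_cong_sets)
qed

lemma distr_uminus_spherical_measure:
  "distr spherical_measure spherical_measure uminus = (spherical_measure :: 'a::euclidean_space measure)"
proof (rule measure_eqI)
  note um = uminus_measurable_spherical_measure[where 'a='a]
  fix A assume A: "A \<in> sets (distr spherical_measure spherical_measure uminus :: 'a measure)"
  then have A': "A \<in> sets (spherical_measure :: 'a measure)" by simp
  let ?B = "uminus -` A \<inter> sphere (0::'a) 1"
  have B: "?B \<in> sets (restrict_space borel (sphere 0 1))"
    using measurable_sets[OF um A'] by simp
  let ?S = "\<lambda>A. {x \<in> cball 0 1 - {0 :: 'a}. sgn x \<in> A}"
  have meas: "?S A \<in> sets borel" using A' by (intro cone_measurable) simp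
  have SB: "?S ?B = (\<lambda>x. (- 1) *\<^sub>R x + 0) ` ?S A"
  proof (intro set_eqI iffI)
    fix x assume "x \<in> ?S ?B"
    then have "- x \<in> ?S A" "x = (- 1) *\<^sub>R (- x) + 0" by (auto simp: sgn_minus)
    then show "x \<in> (\<lambda>x. (- 1) *\<^sub>R x + 0) ` ?S A" by blast
  qed (auto simp: sgn_minus norm_sgn)
  have "emeasure lebesgue (?S ?B) = emeasure lebesgue (?S A)"
    unfolding SB by (subst emeasure_lebesgue_affine) simp
  moreover have "?S ?B \<in> sets borel"
  proof -
    have "uminus -` ?S A \<in> sets borel"
      using measurable_sets[OF _ meas, of uminus borel] by simp
    also have "uminus -` ?S A = ?S ?B" by (auto simp: sgn_minus norm_sgn)
    finally show ?thesis .
  qed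
  ultimately have *: "emeasure lborel (?S ?B) = emeasure lborel (?S A)"
    using meas by simp
  have "emeasure (distr spherical_measure spherical_measure uminus) A = emeasure spherical_measure ?B"
    using emeasure_distr[OF um A'] by simp
  also have "\<dots> = emeasure spherical_measure A"
    using B A' * by (simp add: emeasure_spherical_measure)
  finally show "emeasure (distr spherical_measure spherical_measure uminus) A = emeasure spherical_measure A" .
qed simp

lemma integral_spherical_measure_uminus:
  fixes g :: "'a::euclidean_space \<Rightarrow> real"
  assumes "continuous_on (sphere 0 1) g"
  shows "(\<integral>v. g (- v) \<partial>spherical_measure) = (\<integral>v. g v \<partial>spherical_measure)"
proof -
  note um = uminus_measurable_spherical_measure[where 'a='a]
  have "(\<integral>v. g v \<partial>spherical_measure) = (\<integral>v. g v \<partial>distr spherical_measure spherical_measure uminus)"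
    by (simp add: distr_uminus_spherical_measure)
  also have "\<dots> = (\<integral>v. g (- v) \<partial>spherical_measure)"
    by (rule integral_distr[OF um continuous_sphere_measurable[OF assms]])
  finally show ?thesis ..
qed

text \<open>If \<open>g\<close> were nonzero somewhere, the cone over the set where it is nonzero would contain a
  nonempty open set.\<close>

lemma continuous_nonneg_integral_sphere_zero:
  fixes g :: "'a::euclidean_space \<Rightarrow> real"
  assumes g: "continuous_on (sphere 0 1) g" "\<And>v. v \<in> sphere 0 1 \<Longrightarrow> 0 \<le> g v"
    and 0: "(\<integral>v. g v \<partial>spherical_measure) = 0" and v: "v \<in> sphere 0 1"
  shows "g v = 0"
proof (rule ccontr)
  assume nz: "g v \<noteq> 0"
  have "AE v in spherical_measure. g v = 0"
    using 0 g by (subst (asm) integral_nonneg_eq_0_iff_AE) (auto intro: continuous_sphere_integrable)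
  have meas: "{v \<in> sphere 0 1. g v \<noteq> 0} \<in> sets (restrict_space borel (sphere 0 1))"
  proof -
    have "{v \<in> sphere 0 1. g v \<noteq> 0} = g -` (- {0}) \<inter> space spherical_measure" by auto
    then show ?thesis
      using measurable_sets[OF continuous_sphere_measurable[OF g(1)], of "- {0}"] by simp
  qed
  have "emeasure spherical_measure {v \<in> sphere 0 1. g v \<noteq> 0} = 0"
    using AE_iff_measurable[of "{v \<in> sphere 0 1. g v \<noteq> 0}" spherical_measure "\<lambda>v. g v = 0"] meas \<open>AE v in _. _\<close>
    by simp
  then have "of_nat DIM('a) * emeasure lborel {x \<in> cball 0 1 - {0}. sgn x \<in> {v \<in> sphere 0 1. g v \<noteq> 0}} = 0"
    using emeasure_spherical_measure[OF meas] by simp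
  then have *: "emeasure lborel {x \<in> cball 0 1 - {0}. sgn x \<in> {v \<in> sphere 0 1. g v \<noteq> 0}} = 0"
    unfolding mult_eq_0_iff by (simp only: of_nat_eq_0_iff) (simp only: DIM_positive[THEN less_imp_neq, symmetric] simp_thms)
  let ?U = "{x \<in> ball 0 1 - {0}. g (sgn x) \<in> - {0}}"
  have "continuous_on (ball 0 1 - {0}) (\<lambda>x. g (sgn x))"
  proof (rule continuous_on_compose2[OF g(1)])
    show "continuous_on (ball 0 1 - {0}) (sgn :: 'a \<Rightarrow> 'a)"
      by (rule continuous_on_sgn[OF continuous_on_id]) simp
    show "sgn ` (ball 0 1 - {0}) \<subseteq> sphere (0::'a) 1" by (auto simp: norm_sgn split: if_splits)
  qed
  then have "open ((ball 0 1 - {0}) \<inter> (\<lambda>x. g (sgn x)) -` (- {0}))"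
    by (rule continuous_open_preimage) (simp_all add: open_Diff open_Compl)
  also have "(ball 0 1 - {0}) \<inter> (\<lambda>x. g (sgn x)) -` (- {0}) = ?U" by blast
  finally have "open ?U" .
  moreover have "?U \<noteq> {}"
  proof -
    have "sgn ((1/2) *\<^sub>R v) = v" "v \<noteq> 0" using v by (auto simp: sgn_scaleR sgn_div_norm)
    then have "(1/2) *\<^sub>R v \<in> ?U" using v nz by simp
    then show ?thesis by blast
  qed
  ultimately have "\<not> negligible ?U" by (rule open_not_negligible)
  moreover have "emeasure lborel ?U = 0"
  proof -
    have "emeasure lborel ?U \<le> emeasure lborel {x \<in> cball 0 1 - {0}. sgn x \<in> {v \<in> sphere 0 1. g v \<noteq> 0}}"
    proof (rule emeasure_mono)
      show "{x \<in> cball 0 1 - {0}. sgn x \<in> {v \<in> sphere 0 1. g v \<noteq> 0}} \<in> sets lborel"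
        using cone_measurable[OF meas] by (simp only: sets_lborel)
      show "?U \<subseteq> {x \<in> cball 0 1 - {0}. sgn x \<in> {v \<in> sphere 0 1. g v \<noteq> 0}}"
      proof
        fix x assume "x \<in> ?U"
        then have "x \<in> ball 0 1" "x \<noteq> 0" "g (sgn x) \<noteq> 0" by simp_all
        moreover from this have "norm (sgn x) = 1" by (subst norm_sgn) simp
        ultimately show "x \<in> {x \<in> cball 0 1 - {0}. sgn x \<in> {v \<in> sphere 0 1. g v \<noteq> 0}}"
          by simp
      qed
    qed
    also note *
    finally show ?thesis by simp
  qed
  then have "?U \<in> null_sets lborel" using \<open>open ?U\<close> by (intro null_setsI) simp_all
  then have "negligible ?U" unfolding negligible_iff_null_sets by (rule null_sets_completionI)
  ultimately show False by simp
qed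

section \<open>Existence of moment bodies\<close>

text \<open>The body is the Wulff shape of \<open>h\<close>, the intersection of all halfspaces \<open>{y. u \<bullet> y \<le> h u}\<close>. The
  hypothesis provides a contact point for every direction, which makes \<open>h\<close> its support function.\<close>

theorem exists_body_with_support_fun:
  fixes h :: "'a::euclidean_space \<Rightarrow> real"
  assumes pos: "\<And>u. u \<in> sphere 0 1 \<Longrightarrow> 0 < h u"
    and contact: "\<And>u. u \<in> sphere 0 1 \<Longrightarrow> \<exists>y. u \<bullet> y = h u \<and> (\<forall>w\<in>sphere 0 1. w \<bullet> y \<le> h w)"
  shows "\<exists>K. compact K \<and> convex K \<and> 0 \<in> interior K \<and> (\<forall>u\<in>sphere 0 1. support_fun K u = h u)"
proof -
  define K where "K = (\<Inter>u\<in>sphere 0 1. {y. u \<bullet> y \<le> h u})"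
  have K: "y \<in> K \<longleftrightarrow> (\<forall>u\<in>sphere 0 1. u \<bullet> y \<le> h u)" for y by (simp add: K_def)
  have "closed K" unfolding K_def by (intro closed_INT ballI closed_halfspace_le)
  moreover have "bounded K"
  proof (rule boundedI)
    fix y assume y: "y \<in> K"
    have "norm y \<le> (\<Sum>b\<in>Basis. \<bar>y \<bullet> b\<bar>)" by (rule norm_le_l1)
    also have "\<dots> \<le> (\<Sum>b\<in>Basis. h b + h (- b))"
    proof (rule sum_mono)
      fix b :: 'a assume "b \<in> Basis"
      then have b: "b \<in> sphere 0 1" "- b \<in> sphere 0 1" by simp_all
      have "b \<bullet> y \<le> h b" "(- b) \<bullet> y \<le> h (- b)" using y b unfolding K by (metis, metis)
      then show "\<bar>y \<bullet> b\<bar> \<le> h b + h (- b)" using pos[OF b(1)] pos[OF b(2)]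
        by (simp add: inner_commute)
    qed
    finally show "norm y \<le> (\<Sum>b\<in>Basis. h b + h (- b))" .
  qed
  ultimately have cK: "compact K" by (simp add: compact_eq_bounded_closed)
  have vK: "convex K" unfolding K_def by (intro convex_INT convex_halfspace_le)
  have supp: "support_fun K u = h u" if u: "u \<in> sphere 0 1" for u
  proof -
    obtain y where y: "u \<bullet> y = h u" "\<forall>w\<in>sphere 0 1. w \<bullet> y \<le> h w" using contact[OF u] by metis
    then have "y \<in> K" by (simp add: K)
    then have "h u \<le> support_fun K u" using inner_le_support_fun[OF cK, of y u] y by simp
    moreover obtain z where z: "z \<in> K" "support_fun K u = u \<bullet> z"
      using support_fun_attained[OF cK, of u] \<open>y \<in> K\<close> by (metis empty_iff)
    ultimately show ?thesis using u z unfolding K by fastforce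
  qed
  \<comment> \<open>The body reaches strictly beyond the origin in every direction, which keeps the origin off its boundary.\<close>
  have touch: "\<exists>y\<in>K. 0 < a \<bullet> y" if "a \<noteq> 0" for a
  proof -
    have u: "a /\<^sub>R norm a \<in> sphere 0 1" using that by simp
    obtain y where y: "(a /\<^sub>R norm a) \<bullet> y = h (a /\<^sub>R norm a)" "\<forall>w\<in>sphere 0 1. w \<bullet> y \<le> h w"
      using contact[OF u] by metis
    have "0 < (a /\<^sub>R norm a) \<bullet> y" using pos[OF u] y by simp
    then have "0 < a \<bullet> y" using that by (simp add: zero_less_divide_iff divide_inverse_commute[symmetric])
    moreover have "y \<in> K" using y by (simp add: K)
    ultimately show ?thesis ..
  qed
  have "0 \<in> interior K"
  proof (rule ccontr)
    assume 0: "0 \<notin> interior K"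
    show False
    proof (cases "interior K = {}")
      case True
      obtain a b where ab: "a \<noteq> 0" "K \<subseteq> {x. a \<bullet> x = b}"
        using empty_interior_subset_hyperplane[OF vK True] by metis
      obtain y where "y \<in> K" "0 < a \<bullet> y" using touch[OF ab(1)] ..
      moreover obtain z where "z \<in> K" "0 < (- a) \<bullet> z" using touch[of "- a"] ab(1) by force
      moreover have "a \<bullet> y = b" "a \<bullet> z = b" using ab \<open>y \<in> K\<close> \<open>z \<in> K\<close> by auto
      ultimately show False by simp
    next
      case False
      obtain a where a: "a \<noteq> 0" "\<forall>x\<in>interior K. 0 \<le> a \<bullet> x"
        using separating_hyperplane_set_0[OF convex_interior[OF vK] 0] by metis
      have "K \<subseteq> closure (interior K)"
        using convex_closure_interior[OF vK False] closure_subset[of K] by simp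
      also have "\<dots> \<subseteq> {x. a \<bullet> x \<ge> 0}"
        using a by (intro closure_minimal closed_halfspace_ge) auto
      finally have "\<forall>x\<in>K. 0 \<le> a \<bullet> x" by auto
      moreover obtain z where "z \<in> K" "0 < (- a) \<bullet> z" using touch[of "- a"] a(1) by force
      ultimately show False by force
    qed
  qed
  with cK vK supp show ?thesis by blast
qed

text \<open>The \<open>p\<close>-th power of the support function of the moment body \<open>M\<^sub>p\<^sup>+\<close>, up to its normalising
  constant, with a density \<open>g\<close> in place of the power of the radial function. All the bodies of the
  family arise from suitable densities.\<close>

definition moment_powr :: "real \<Rightarrow> ('a::euclidean_space \<Rightarrow> real) \<Rightarrow> 'a \<Rightarrow> real" where
  "moment_powr p g u = (\<integral>v. max (u \<bullet> v) 0 powr p * g v \<partial>spherical_measure)"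

lemma continuous_on_max_inner_powr:
  fixes u :: "'a::real_inner"
  assumes "p > 0"
  shows "continuous_on S (\<lambda>v. max (u \<bullet> v) 0 powr p)"
  by (rule continuous_on_powr') (use assms in \<open>auto intro!: continuous_intros\<close>)

lemma moment_powr_pos:
  fixes g :: "'a::euclidean_space \<Rightarrow> real"
  assumes "p > 0" and g: "continuous_on (sphere 0 1) g" "\<And>v. v \<in> sphere 0 1 \<Longrightarrow> 0 < g v"
    and u: "u \<in> sphere 0 1"
  shows "0 < moment_powr p g u"
proof -
  have cont: "continuous_on (sphere 0 1) (\<lambda>v. max (u \<bullet> v) 0 powr p * g v)"
    by (intro continuous_on_mult continuous_on_max_inner_powr assms)
  have nonneg: "0 \<le> max (u \<bullet> v) 0 powr p * g v" if "v \<in> sphere 0 1" for v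
    using g(2)[OF that] by simp
  have "u \<bullet> u = 1" using u by (simp add: norm_eq_1)
  then have "max (u \<bullet> u) 0 powr p * g u \<noteq> 0" using g(2)[OF u] by simp
  then have "moment_powr p g u \<noteq> 0"
    using continuous_nonneg_integral_sphere_zero[OF cont nonneg _ u] unfolding moment_powr_def by metis
  moreover have "0 \<le> moment_powr p g u"
    unfolding moment_powr_def using nonneg by (intro integral_nonneg_AE AE_I2) simp
  ultimately show ?thesis by simp
qed

text \<open>Young's inequality for \<open>x / a\<close> and \<open>y / b\<close>; integrated with \<open>a\<close> and \<open>b\<close> the two \<open>L\<^sup>p\<close> norms
  it becomes Hoelder's inequality.\<close>

lemma Young_powr:
  fixes x y a b p :: real
  assumes "0 \<le> x" "0 \<le> y" "0 < a" "0 < b" "1 < p"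
  shows "x powr (p - 1) * y \<le> a powr (p - 1) * b * ((1 - 1 / p) * (x powr p / a powr p) + 1 / p * (y powr p / b powr p))"
proof -
  have 1: "((x / a) powr p) powr (1 - 1 / p) = x powr (p - 1) / a powr (p - 1)"
    using assms by (simp add: powr_powr powr_divide right_diff_distrib)
  have 2: "((y / b) powr p) powr (1 - (1 - 1 / p)) = y / b"
    using assms by (simp add: powr_powr)
  have "((x / a) powr p) powr (1 - 1 / p) * ((y / b) powr p) powr (1 - (1 - 1 / p))
     \<le> (1 - 1 / p) * (x / a) powr p + (1 - (1 - 1 / p)) * (y / b) powr p"
    using assms by (intro weighted_AM_GM) auto
  then have "x powr (p - 1) / a powr (p - 1) * (y / b)
     \<le> (1 - 1 / p) * (x powr p / a powr p) + 1 / p * (y powr p / b powr p)"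
    unfolding 1 2 using assms by (simp add: powr_divide)
  then have "a powr (p - 1) * b * (x powr (p - 1) / a powr (p - 1) * (y / b))
     \<le> a powr (p - 1) * b * ((1 - 1 / p) * (x powr p / a powr p) + 1 / p * (y powr p / b powr p))"
    using assms by (intro mult_left_mono) auto
  moreover have "a powr (p - 1) * b * (x powr (p - 1) / a powr (p - 1) * (y / b)) = x powr (p - 1) * y"
    using assms by simp
  ultimately show ?thesis by simp
qed

text \<open>Where \<open>h\<close> is the \<open>p\<close>-th root of the prescribed function, the contact point in direction \<open>u\<close> is
  the gradient of \<open>h\<close> at \<open>u\<close>, a vector-valued integral. That it satisfies \<open>w \<bullet> y \<le> h w\<close> is Hoelder's
  inequality.\<close>

theorem exists_moment_body:
  fixes g :: "'a::euclidean_space \<Rightarrow> real"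
  assumes p: "1 < p" and c: "0 < c"
    and g: "continuous_on (sphere 0 1) g" "\<And>v. v \<in> sphere 0 1 \<Longrightarrow> 0 < g v"
  shows "\<exists>K. has_support_powr p (\<lambda>u. c * moment_powr p g u) K"
proof -
  define h where "h u = (c * moment_powr p g u) powr (1 / p)" for u
  have mpos: "0 < moment_powr p g u" if "u \<in> sphere 0 1" for u
    using moment_powr_pos[OF _ g that] p by simp
  have hpos: "0 < h u" if "u \<in> sphere 0 1" for u using mpos[OF that] c unfolding h_def by simp
  have hp: "h u powr p = c * moment_powr p g u" if "u \<in> sphere 0 1" for u
    using mpos[OF that] c p by (simp add: h_def powr_powr)
  have "\<exists>y. u \<bullet> y = h u \<and> (\<forall>w\<in>sphere 0 1. w \<bullet> y \<le> h w)" if u: "u \<in> sphere 0 1" for u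
  proof -
    define a where "a = h u"
    have a: "a > 0" using hpos[OF u] by (simp add: a_def)
    define F where "F v = (max (u \<bullet> v) 0 powr (p - 1) * g v) *\<^sub>R v" for v
    have "continuous_on (sphere 0 1) F"
      unfolding F_def using p
      by (intro continuous_on_scaleR continuous_on_mult continuous_on_max_inner_powr g continuous_on_id) simp
    then have intF: "integrable spherical_measure F" by (rule continuous_sphere_integrable)
    \<comment> \<open>The gradient of \<open>h\<close> at \<open>u\<close>.\<close>
    define y where "y = (a powr (1 - p) * c) *\<^sub>R (\<integral>v. F v \<partial>spherical_measure)"
    have inner_y: "w \<bullet> y = a powr (1 - p) * c * (\<integral>v. max (u \<bullet> v) 0 powr (p - 1) * (w \<bullet> v) * g v \<partial>spherical_measure)" for w
    proof -
      have "w \<bullet> (\<integral>v. F v \<partial>spherical_measure) = (\<integral>v. w \<bullet> F v \<partial>spherical_measure)"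
        using intF by simp
      also have "\<dots> = (\<integral>v. max (u \<bullet> v) 0 powr (p - 1) * (w \<bullet> v) * g v \<partial>spherical_measure)"
        by (simp add: F_def mult_ac)
      finally show ?thesis by (simp add: y_def)
    qed
    have int_m: "integrable spherical_measure (\<lambda>v. max (w \<bullet> v) 0 powr p * g v)" for w
      using p by (intro continuous_sphere_integrable continuous_on_mult continuous_on_max_inner_powr g) simp
    have "u \<bullet> y = h u"
    proof -
      have "max t 0 powr (p - 1) * t = max t 0 powr p" for t :: real
        using p by (cases "t > 0") (auto simp: powr_diff max_def)
      then have "u \<bullet> y = a powr (1 - p) * (c * moment_powr p g u)"
        by (simp add: inner_y moment_powr_def)
      also have "\<dots> = a" using a unfolding hp[OF u, symmetric] a_def[symmetric] by (simp flip: powr_add)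
      finally show ?thesis by (simp add: a_def)
    qed
    moreover have "w \<bullet> y \<le> h w" if w: "w \<in> sphere 0 1" for w
    proof -
      define b where "b = h w"
      have b: "b > 0" using hpos[OF w] by (simp add: b_def)
      have "(\<integral>v. max (u \<bullet> v) 0 powr (p - 1) * (w \<bullet> v) * g v \<partial>spherical_measure)
        \<le> (\<integral>v. a powr (p - 1) * b * ((1 - 1 / p) / a powr p * (max (u \<bullet> v) 0 powr p * g v)
            + 1 / p / b powr p * (max (w \<bullet> v) 0 powr p * g v)) \<partial>spherical_measure)"
      proof (rule integral_mono)
        show "integrable spherical_measure (\<lambda>v. max (u \<bullet> v) 0 powr (p - 1) * (w \<bullet> v) * g v)"
          using p by (intro continuous_sphere_integrable continuous_on_mult continuous_on_max_inner_powr g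
            continuous_on_inner continuous_on_const continuous_on_id) simp
        show "integrable spherical_measure (\<lambda>v. a powr (p - 1) * b * ((1 - 1 / p) / a powr p * (max (u \<bullet> v) 0 powr p * g v)
            + 1 / p / b powr p * (max (w \<bullet> v) 0 powr p * g v)))"
          by (intro integrable_mult_right Bochner_Integration.integrable_add int_m)
        fix v :: 'a assume "v \<in> space spherical_measure"
        then have v: "0 < g v" using g(2)[of v] by simp
        have "max (u \<bullet> v) 0 powr (p - 1) * (w \<bullet> v) \<le> max (u \<bullet> v) 0 powr (p - 1) * max (w \<bullet> v) 0"
          by (intro mult_left_mono) auto
        also have "\<dots> \<le> a powr (p - 1) * b * ((1 - 1 / p) * (max (u \<bullet> v) 0 powr p / a powr p)
           + 1 / p * (max (w \<bullet> v) 0 powr p / b powr p))"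
          using a b p by (intro Young_powr) auto
        finally have "max (u \<bullet> v) 0 powr (p - 1) * (w \<bullet> v) * g v
          \<le> a powr (p - 1) * b * ((1 - 1 / p) * (max (u \<bullet> v) 0 powr p / a powr p)
           + 1 / p * (max (w \<bullet> v) 0 powr p / b powr p)) * g v"
          using v by (intro mult_right_mono) auto
        also have "\<dots> = a powr (p - 1) * b * ((1 - 1 / p) / a powr p * (max (u \<bullet> v) 0 powr p * g v)
            + 1 / p / b powr p * (max (w \<bullet> v) 0 powr p * g v))"
          by (simp add: distrib_left distrib_right mult_ac)
        finally show "max (u \<bullet> v) 0 powr (p - 1) * (w \<bullet> v) * g v
          \<le> a powr (p - 1) * b * ((1 - 1 / p) / a powr p * (max (u \<bullet> v) 0 powr p * g v)
            + 1 / p / b powr p * (max (w \<bullet> v) 0 powr p * g v))" .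
      qed
      also have "\<dots> = a powr (p - 1) * b * ((1 - 1 / p) / a powr p * moment_powr p g u + 1 / p / b powr p * moment_powr p g w)"
        using int_m by (simp add: moment_powr_def)
      finally have "c * (\<integral>v. max (u \<bullet> v) 0 powr (p - 1) * (w \<bullet> v) * g v \<partial>spherical_measure)
        \<le> c * (a powr (p - 1) * b * ((1 - 1 / p) / a powr p * moment_powr p g u + 1 / p / b powr p * moment_powr p g w))"
        using c by (intro mult_left_mono) auto
      also have "\<dots> = a powr (p - 1) * b * ((1 - 1 / p) / a powr p * (c * moment_powr p g u) + 1 / p / b powr p * (c * moment_powr p g w))"
        by (simp add: algebra_simps)
      also have "\<dots> = a powr (p - 1) * b"
        using a b unfolding hp[OF u, symmetric] hp[OF w, symmetric] a_def[symmetric] b_def[symmetric] by simp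
      finally have "a powr (1 - p) * (c * (\<integral>v. max (u \<bullet> v) 0 powr (p - 1) * (w \<bullet> v) * g v \<partial>spherical_measure))
        \<le> a powr (1 - p) * (a powr (p - 1) * b)"
        by (intro mult_left_mono) auto
      also have "\<dots> = b" using a by (simp flip: powr_add mult.assoc)
      finally show ?thesis by (simp add: inner_y b_def)
    qed
    ultimately show ?thesis by metis
  qed
  then obtain K where "compact K" "convex K" "0 \<in> interior K" "\<forall>u\<in>sphere 0 1. support_fun K u = h u"
    using exists_body_with_support_fun[of h] hpos by metis
  then show ?thesis using hp unfolding has_support_powr_def by metis
qed

section \<open>Gaussian moments of absolute powers\<close>

text \<open>The odd kernel \<open>max t 0 powr p - max (- t) 0 powr p\<close>: integrating it against \<open>g\<close> compares the
  values of \<^const>\<open>moment_powr\<close> at \<open>u\<close> and \<open>- u\<close>.\<close>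

definition signed_powr :: "real \<Rightarrow> real \<Rightarrow> real" where
  "signed_powr p t = sgn t * \<bar>t\<bar> powr p"

lemma signed_powr_measurable [measurable]: "signed_powr p \<in> borel_measurable borel"
  unfolding signed_powr_def by measurable

lemma abs_signed_powr: "\<bar>signed_powr p t\<bar> = \<bar>t\<bar> powr p"
  by (simp add: signed_powr_def abs_mult sgn_if)

lemma signed_powr_minus: "signed_powr p (- t) = - signed_powr p t"
  by (simp add: signed_powr_def)

lemma abs_powr_le_exp: "q \<ge> 0 \<Longrightarrow> \<bar>b :: real\<bar> powr q \<le> exp (q * \<bar>b\<bar>)"
proof -
  assume q: "q \<ge> 0"
  have "\<bar>b\<bar> \<le> exp \<bar>b\<bar>" using exp_ge_add_one_self[of "\<bar>b\<bar>"] by linarith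
  then have "\<bar>b\<bar> powr q \<le> exp \<bar>b\<bar> powr q" using q by (intro powr_mono2) auto
  also have "\<dots> = exp (q * \<bar>b\<bar>)" by (simp add: powr_def)
  finally show ?thesis .
qed

text \<open>Completing the square.\<close>

lemma std_normal_density_exp:
  "std_normal_density b * exp (y * b) = exp (y\<^sup>2 / 2) * normal_density y 1 b"
proof -
  have "- (b\<^sup>2) / 2 + y * b = y\<^sup>2 / 2 + - ((b - y)\<^sup>2) / 2" by (simp add: power2_eq_square field_simps)
  then have "exp (- (b\<^sup>2) / 2) * exp (y * b) = exp (y\<^sup>2 / 2) * exp (- ((b - y)\<^sup>2) / 2)"
    by (simp only: exp_add[symmetric])
  then show ?thesis by (simp add: normal_density_def field_simps)
qed

lemma integrable_exp_abs_normal: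
  "integrable lborel (\<lambda>b. exp (c * \<bar>b\<bar>) * std_normal_density b)"
proof (rule Bochner_Integration.integrable_bound)
  show "integrable lborel (\<lambda>b. exp (c\<^sup>2 / 2) * normal_density c 1 b + exp ((- c)\<^sup>2 / 2) * normal_density (- c) 1 b)"
    by (intro Bochner_Integration.integrable_add integrable_mult_right integrable_normal_density) simp_all
  have "exp (c * \<bar>b\<bar>) * std_normal_density b \<le> std_normal_density b * exp (c * b) + std_normal_density b * exp (- c * b)" for b
    by (cases "b \<ge> 0") (simp_all add: mult.commute)
  then show "AE b in lborel. norm (exp (c * \<bar>b\<bar>) * std_normal_density b)
    \<le> norm (exp (c\<^sup>2 / 2) * normal_density c 1 b + exp ((- c)\<^sup>2 / 2) * normal_density (- c) 1 b)"
    unfolding std_normal_density_exp by (intro AE_I2) simp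
qed simp

lemma integrable_powr_exp_normal:
  assumes "q \<ge> 0"
  shows "integrable lborel (\<lambda>b. \<bar>b\<bar> powr q * exp (c * \<bar>b\<bar>) * std_normal_density b)"
proof (rule Bochner_Integration.integrable_bound[OF integrable_exp_abs_normal[of "q + c"]])
  have "\<bar>b\<bar> powr q * exp (c * \<bar>b\<bar>) \<le> exp ((q + c) * \<bar>b\<bar>)" for b
    using mult_right_mono[OF abs_powr_le_exp[OF assms, of b], of "exp (c * \<bar>b\<bar>)"]
    by (simp add: exp_add distrib_right)
  then show "AE b in lborel. norm (\<bar>b\<bar> powr q * exp (c * \<bar>b\<bar>) * std_normal_density b)
    \<le> norm (exp ((q + c) * \<bar>b\<bar>) * std_normal_density b)"
    by (intro AE_I2) (simp add: abs_mult mult_right_mono)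
qed simp

definition abs_moment :: "real \<Rightarrow> real" where
  "abs_moment q = (\<integral>b. \<bar>b\<bar> powr q * std_normal_density b \<partial>lborel)"

lemma integrable_abs_moment: "q \<ge> 0 \<Longrightarrow> integrable lborel (\<lambda>b. \<bar>b\<bar> powr q * std_normal_density b)"
  using integrable_powr_exp_normal[of q 0] by simp

lemma abs_moment_pos:
  assumes "q \<ge> 0"
  shows "0 < abs_moment q"
proof -
  have nn: "AE b in lborel. 0 \<le> \<bar>b\<bar> powr q * std_normal_density b" by (intro AE_I2) simp
  have "abs_moment q \<noteq> 0"
  proof
    assume "abs_moment q = 0"
    then have "AE b in lborel. \<bar>b\<bar> powr q * std_normal_density b = 0"
      using integral_nonneg_eq_0_iff_AE[OF integrable_abs_moment[OF assms] nn] by (simp add: abs_moment_def)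
    then have "AE b in lborel. b = (0::real)"
    proof (rule eventually_mono)
      fix b :: real assume "\<bar>b\<bar> powr q * std_normal_density b = 0"
      then show "b = 0" using normal_density_pos[of 1 0 b] by simp
    qed
    then have "AE b in (lborel :: real measure). False"
      using AE_lborel_singleton[of 0] by eventually_elim simp
    then show False by (simp add: eventually_False ae_filter_eq_bot_iff)
  qed
  moreover have "abs_moment q \<ge> 0" unfolding abs_moment_def by (rule integral_nonneg_AE[OF nn])
  ultimately show ?thesis by simp
qed

text \<open>The function \<open>b * \<bar>b\<bar> powr q\<close> is differentiable at the origin too, which allows integration by
  parts over the whole line at once.\<close>

lemma DERIV_mult_abs_powr:
  assumes q: "q > 0"
  shows "((\<lambda>b. b * \<bar>b\<bar> powr q) has_real_derivative (q + 1) * \<bar>x\<bar> powr q) (at x)"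
proof -
  consider "x > 0" | "x < 0" | "x = 0" by linarith
  then show ?thesis
  proof cases
    case 1
    have "((\<lambda>b. b * b powr q) has_real_derivative (q + 1) * \<bar>x\<bar> powr q) (at x)"
      using 1 by (auto intro!: derivative_eq_intros simp: powr_diff field_simps)
    then show ?thesis
      by (rule has_field_derivative_transform_within_open[where S="{0<..}"]) (use 1 in auto)
  next
    case 2
    have "((\<lambda>b. b * (- b) powr q) has_real_derivative (q + 1) * \<bar>x\<bar> powr q) (at x)"
      using 2 by (auto intro!: derivative_eq_intros simp: powr_diff field_simps)
    then show ?thesis
      by (rule has_field_derivative_transform_within_open[where S="{..<0}"]) (use 2 in auto)
  next
    case 3
    have "((\<lambda>h::real. \<bar>h\<bar> powr q) \<longlongrightarrow> \<bar>0\<bar> powr q) (at 0)"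
      using q by (intro tendsto_powr' tendsto_rabs tendsto_ident_at) auto
    then have "((\<lambda>h::real. \<bar>h\<bar> powr q) \<longlongrightarrow> 0) (at 0)" by simp
    then have "((\<lambda>h::real. (h * \<bar>h\<bar> powr q) / h) \<longlongrightarrow> 0) (at 0)"
      by (rule Lim_transform_eventually) (auto simp: eventually_at_filter)
    then show ?thesis using 3 by (simp add: DERIV_def)
  qed
qed

text \<open>Integration by parts, from \<open>b * std_normal_density b\<close> being minus the derivative of the density.\<close>

lemma abs_moment_rec:
  assumes q: "q > 0"
  shows "abs_moment (q + 2) = (q + 1) * abs_moment q"
proof -
  \<comment> \<open>\<open>f\<close> is the derivative of \<open>F\<close>, and \<open>F\<close> vanishes at both ends of the line.\<close>
  define F where "F = (\<lambda>b::real. b * \<bar>b\<bar> powr q * std_normal_density b)"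
  define f where "f = (\<lambda>b::real. (q + 1) * (\<bar>b\<bar> powr q * std_normal_density b) - \<bar>b\<bar> powr (q + 2) * std_normal_density b)"
  have sq: "x * \<bar>x\<bar> powr q * x = \<bar>x\<bar> powr (q + 2)" for x :: real
    by (cases "x = 0") (auto simp: powr_add power2_eq_square)
  have D: "(F has_real_derivative f x) (at x)" for x
  proof -
    have n: "(std_normal_density has_real_derivative - x * std_normal_density x) (at x)"
    proof -
      define c where "c = 1 / sqrt (2 * pi)"
      have "((\<lambda>x. c * exp (- x\<^sup>2 / 2)) has_real_derivative - x * (c * exp (- x\<^sup>2 / 2))) (at x)"
        by (auto intro!: derivative_eq_intros)
      then show ?thesis unfolding std_normal_density_def c_def .
    qed
    show ?thesis unfolding F_def f_def
      by (rule DERIV_cong[OF DERIV_mult[OF DERIV_mult_abs_powr[OF q] n]]) (simp add: sq[symmetric] algebra_simps)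
  qed
  have intf: "integrable lborel f"
    unfolding f_def using q
    by (intro Bochner_Integration.integrable_diff integrable_mult_right integrable_abs_moment) auto
  have top: "(F \<longlongrightarrow> 0) at_top"
  proof -
    have "((\<lambda>b. b * b powr q * (1 / sqrt (2 * pi) * exp (- b\<^sup>2 / 2))) \<longlongrightarrow> 0) at_top"
      using q by real_asymp
    then show ?thesis
    proof (rule Lim_transform_eventually)
      show "\<forall>\<^sub>F b in at_top. b * b powr q * (1 / sqrt (2 * pi) * exp (- b\<^sup>2 / 2)) = F b"
        using eventually_gt_at_top[of 0] by eventually_elim (simp add: F_def std_normal_density_def)
    qed
  qed
  have F_odd: "F (- b) = - F b" for b by (simp add: F_def std_normal_density_def)
  have bot: "(F \<longlongrightarrow> 0) at_bot"
    using tendsto_minus[OF top] unfolding filterlim_at_bot_mirror F_odd by simp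
  have pw: "continuous_on UNIV (\<lambda>b::real. \<bar>b\<bar> powr r)" if "r > 0" for r
    by (rule continuous_on_powr') (use that in \<open>auto intro: continuous_on_rabs continuous_on_id\<close>)
  have dens: "continuous_on UNIV std_normal_density"
    unfolding std_normal_density_def by (intro continuous_intros) simp_all
  have "continuous_on UNIV f"
    unfolding f_def using q
    by (intro continuous_on_diff continuous_on_mult continuous_on_const pw dens) simp_all
  then have cont: "isCont f x" for x by (simp add: continuous_on_eq_continuous_at)
  have "(LBINT x=-\<infinity>..\<infinity>. f x) = 0 - 0"
  proof (rule interval_integral_FTC_integrable)
    show "(F has_vector_derivative f x) (at x)" for x
      using D[of x] by (simp add: has_real_derivative_iff_has_vector_derivative)
    show "isCont f x" for x by (rule cont)
    show "set_integrable lborel (einterval (- \<infinity>) \<infinity>) f"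
      using intf by (simp add: set_integrable_def einterval_def)
    show "((F \<circ> real_of_ereal) \<longlongrightarrow> 0) (at_right (- \<infinity>))" "((F \<circ> real_of_ereal) \<longlongrightarrow> 0) (at_left \<infinity>)"
      using top bot by (simp_all add: ereal_tendsto_simps)
  qed simp
  then have "(\<integral>x. f x \<partial>lborel) = 0"
    by (simp add: interval_lebesgue_integral_def set_lebesgue_integral_def einterval_def)
  moreover have "(\<integral>x. f x \<partial>lborel) = (q + 1) * abs_moment q - abs_moment (q + 2)"
    unfolding f_def abs_moment_def using q by (simp add: integrable_abs_moment)
  ultimately show ?thesis by simp
qed

section \<open>Power series of the Gaussian-smoothed signed power\<close>

text \<open>Termwise integration by dominated convergence of the partial sums.\<close>

lemma sums_integral_dominated:
  fixes F :: "nat \<Rightarrow> 'a \<Rightarrow> real"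
  assumes F: "\<And>n. integrable M (F n)" and B: "integrable M B" and f: "f \<in> borel_measurable M"
    and sums: "\<And>x. x \<in> space M \<Longrightarrow> (\<lambda>n. F n x) sums f x"
    and bound: "\<And>n x. x \<in> space M \<Longrightarrow> (\<Sum>k<n. \<bar>F k x\<bar>) \<le> B x"
  shows "(\<lambda>n. \<integral>x. F n x \<partial>M) sums (\<integral>x. f x \<partial>M)"
proof -
  have "(\<lambda>n. \<integral>x. (\<Sum>k<n. F k x) \<partial>M) \<longlonglongrightarrow> (\<integral>x. f x \<partial>M)"
  proof (rule integral_dominated_convergence[where w=B])
    show "AE x in M. (\<lambda>n. \<Sum>k<n. F k x) \<longlonglongrightarrow> f x"
      using sums by (intro AE_I2) (simp add: sums_def)
    show "AE x in M. norm (\<Sum>k<n. F k x) \<le> B x" for n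
      using order_trans[OF sum_abs bound] by (intro AE_I2) simp
    show "(\<lambda>x. \<Sum>k<n. F k x) \<in> borel_measurable M" for n
      using F by (intro borel_measurable_sum) auto
  qed (use B f in auto)
  then show ?thesis using F by (simp add: sums_def)
qed

text \<open>The signed power convolved with the standard Gaussian. As a function of \<open>y\<close> it is entire, and
  the dependence on \<open>p\<close> is carried by its Taylor coefficients.\<close>

definition gauss_smooth :: "real \<Rightarrow> real \<Rightarrow> real" where
  "gauss_smooth p y = (\<integral>b. signed_powr p b * normal_density y 1 b \<partial>lborel)"

lemma signed_moment:
  assumes "p > 0"
  shows "(\<integral>b. signed_powr p b * b ^ m * std_normal_density b \<partial>lborel)
    = (if odd m then abs_moment (p + real m) else 0)"
proof (cases "odd m")
  case True
  have "signed_powr p b * b ^ m = \<bar>b\<bar> powr (p + real m)" for b :: real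
  proof (cases "b = 0")
    case False
    have "b ^ m = sgn b * \<bar>b\<bar> ^ m" using True False
      by (cases "b > 0") (auto simp: power_minus_odd)
    then have "signed_powr p b * b ^ m = (sgn b * sgn b) * (\<bar>b\<bar> powr p * \<bar>b\<bar> ^ m)"
      by (simp add: signed_powr_def)
    also have "sgn b * sgn b = 1" using False by (simp add: sgn_if)
    also have "1 * (\<bar>b\<bar> powr p * \<bar>b\<bar> ^ m) = \<bar>b\<bar> powr (p + real m)"
      using False by (simp add: powr_add powr_realpow)
    finally show ?thesis .
  qed (use assms in \<open>simp add: signed_powr_def\<close>)
  then show ?thesis using True by (simp add: abs_moment_def)
next
  case False
  let ?f = "\<lambda>b. signed_powr p b * b ^ m * std_normal_density b"
  have "(\<integral>b. ?f b \<partial>lborel) = (\<integral>b. ?f (- b) \<partial>lborel)"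
    using lborel_integral_real_affine[of "- 1" ?f 0] by simp
  also have "\<dots> = (\<integral>b. - ?f b \<partial>lborel)"
    using False by (simp add: signed_powr_minus std_normal_density_def)
  also have "\<dots> = - (\<integral>b. ?f b \<partial>lborel)" by simp
  finally show ?thesis using False by simp
qed

text \<open>By completing the square, the left-hand factor turns \<^const>\<open>gauss_smooth\<close> into the exponential
  moment generating function of the signed power, which is expanded termwise.\<close>

lemma gauss_smooth_sums:
  assumes "p > 0"
  shows "(\<lambda>m. (if odd m then abs_moment (p + real m) / fact m else 0) * y ^ m) sums (exp (y\<^sup>2 / 2) * gauss_smooth p y)"
proof -
  define F where "F m b = signed_powr p b * b ^ m * std_normal_density b * (y ^ m / fact m)" for m b
  define f where "f b = signed_powr p b * exp (y * b) * std_normal_density b" for b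
  \<comment> \<open>The dominating function for the partial sums of the exponential series.\<close>
  define B where "B b = \<bar>b\<bar> powr p * exp (\<bar>y\<bar> * \<bar>b\<bar>) * std_normal_density b" for b
  have "(\<lambda>m. \<integral>b. F m b \<partial>lborel) sums (\<integral>b. f b \<partial>lborel)"
  proof (rule sums_integral_dominated)
    show "integrable lborel B"
      unfolding B_def using assms by (intro integrable_powr_exp_normal) simp
    show "f \<in> borel_measurable lborel" unfolding f_def by simp
    show "(\<lambda>n. F n b) sums f b" for b
    proof -
      have "(\<lambda>n. (y * b) ^ n / fact n) sums exp (y * b)"
        using exp_converges[of "y * b"] by (simp add: scaleR_conv_of_real divide_inverse mult.commute)
      then have "(\<lambda>n. signed_powr p b * std_normal_density b * ((y * b) ^ n / fact n))
        sums (signed_powr p b * std_normal_density b * exp (y * b))" by (rule sums_mult)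
      then show ?thesis unfolding F_def f_def by (simp add: power_mult_distrib mult_ac)
    qed
    show bound: "(\<Sum>k<n. \<bar>F k b\<bar>) \<le> B b" for n b
    proof -
      have "(\<Sum>k<n. \<bar>F k b\<bar>) = \<bar>b\<bar> powr p * std_normal_density b * (\<Sum>k<n. (\<bar>y\<bar> * \<bar>b\<bar>) ^ k / fact k)"
        unfolding F_def sum_distrib_left
        by (intro sum.cong refl) (simp add: abs_mult abs_signed_powr power_abs power_mult_distrib)
      also have "\<dots> \<le> \<bar>b\<bar> powr p * std_normal_density b * exp (\<bar>y\<bar> * \<bar>b\<bar>)"
      proof (rule mult_left_mono)
        have s: "(\<lambda>n. (\<bar>y\<bar> * \<bar>b\<bar>) ^ n / fact n) sums exp (\<bar>y\<bar> * \<bar>b\<bar>)"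
          using exp_converges[of "\<bar>y\<bar> * \<bar>b\<bar>"] by (simp add: scaleR_conv_of_real divide_inverse mult.commute)
        show "(\<Sum>k<n. (\<bar>y\<bar> * \<bar>b\<bar>) ^ k / fact k) \<le> exp (\<bar>y\<bar> * \<bar>b\<bar>)"
          unfolding sums_unique[OF s] by (rule sum_le_suminf) (use s in \<open>auto simp: sums_iff\<close>)
      qed simp
      finally show ?thesis by (simp add: B_def mult_ac)
    qed
    show "integrable lborel (F n)" for n
    proof (rule Bochner_Integration.integrable_bound[OF \<open>integrable lborel B\<close>])
      show "F n \<in> borel_measurable lborel" unfolding F_def by simp
      have "\<bar>F n b\<bar> \<le> B b" for b
      proof -
        have "0 \<le> (\<Sum>k<n. \<bar>F k b\<bar>)" by (intro sum_nonneg) simp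
        moreover have "(\<Sum>k<n. \<bar>F k b\<bar>) + \<bar>F n b\<bar> \<le> B b"
          using bound[where n="Suc n" and b=b] by (simp only: sum.lessThan_Suc)
        ultimately show ?thesis by linarith
      qed
      then show "AE b in lborel. norm (F n b) \<le> norm (B b)"
        by (intro AE_I2) (auto intro: order_trans[OF _ abs_ge_self])
    qed
  qed
  moreover have "(\<integral>b. F m b \<partial>lborel) = (if odd m then abs_moment (p + real m) / fact m else 0) * y ^ m" for m
    unfolding F_def by (simp add: signed_moment[OF assms])
  moreover have "(\<integral>b. f b \<partial>lborel) = exp (y\<^sup>2 / 2) * gauss_smooth p y"
  proof -
    have "f b = exp (y\<^sup>2 / 2) * (signed_powr p b * normal_density y 1 b)" for b
      unfolding f_def using std_normal_density_exp[of b y] by (simp add: mult_ac)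
    then show ?thesis by (simp add: gauss_smooth_def)
  qed
  ultimately show ?thesis by simp
qed

text \<open>Coefficients of \<open>exp (y\<^sup>2 / 2) * gauss_smooth p y / y\<close> as a power series in \<open>y\<^sup>2\<close>.\<close>

definition odd_coeff :: "real \<Rightarrow> real fps" where
  "odd_coeff p = Abs_fps (\<lambda>j. abs_moment (p + real (2 * j + 1)) / fact (2 * j + 1))"

lemma odd_coeff_rec:
  assumes "p > 0"
  shows "(real j + 1) * (real j + 3 / 2) * fps_nth (odd_coeff p) (Suc j)
    = (real j / 2 + p / 4 + 1 / 2) * fps_nth (odd_coeff p) j"
proof -
  have eq: "p + real (2 * Suc j + 1) = (p + real (2 * j + 1)) + 2" by simp
  have A: "abs_moment (p + real (2 * Suc j + 1)) = (p + real (2 * j + 1) + 1) * abs_moment (p + real (2 * j + 1))"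
    unfolding eq using assms by (intro abs_moment_rec) simp
  have "(fact (2 * Suc j + 1) :: real) = (2 * real j + 3) * (2 * real j + 2) * fact (2 * j + 1)"
    by (simp add: algebra_simps)
  then show ?thesis
    unfolding odd_coeff_def fps_nth_Abs_fps A by (simp add: divide_simps) (simp add: algebra_simps)
qed

text \<open>The two sides of the confluent hypergeometric differential equation
  \<open>X F'' + t F' = h X F' + d F\<close>, in terms of coefficients: the equation is a two-term recurrence.\<close>

lemma fps_nth_second_order_operator:
  fixes F :: "real fps"
  shows "fps_nth (fps_X * fps_deriv (fps_deriv F) + fps_const t * fps_deriv F) n
      = (real n + 1) * (real n + t) * fps_nth F (Suc n)"
    and "fps_nth (fps_const h * fps_X * fps_deriv F + fps_const d * F) n
      = (h * real n + d) * fps_nth F n"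
  by (cases n; simp add: mult.assoc algebra_simps)+

text \<open>Coefficients of \<open>gauss_smooth p y / y\<close> as a power series in \<open>y\<^sup>2\<close>; the exponential factor
  is the series of \<open>exp (- y\<^sup>2 / 2)\<close>.\<close>

definition smooth_coeff :: "real \<Rightarrow> real fps" where
  "smooth_coeff p = fps_exp (- 1 / 2) * odd_coeff p"

text \<open>Multiplying a solution of Kummer's differential equation by the exponential gives a solution of
  another equation of the same kind (Kummer's transformation). The factor on the right vanishes
  exactly for \<open>p = 2 j + 1\<close>, and this is how odd integers \<open>p\<close> become exceptional.\<close>

lemma smooth_coeff_rec:
  assumes "p > 0"
  shows "(real j + 1) * (real j + 3 / 2) * fps_nth (smooth_coeff p) (Suc j)
    = ((p - 1) / 4 - real j / 2) * fps_nth (smooth_coeff p) j"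
proof -
  define N where "N = odd_coeff p"
  define E where "E = (fps_exp (- 1 / 2) :: real fps)"
  define G where "G = E * N"
  define h d where "h = (fps_const (1 / 2) :: real fps)" and "d = (fps_const (p / 4 + 1 / 2) :: real fps)"
  define N' N'' where "N' = fps_deriv N" and "N'' = fps_deriv N'"
  have t: "fps_const (3 / 2) = h + h + h" by (simp add: h_def)
  have mh: "fps_const (- 1 / 2) = - h" by (simp add: h_def)
  \<comment> \<open>The constants are kept as symbols, so that the differential equation for \<open>G\<close> follows by ring normalisation.\<close>
  have c: "fps_const ((p - 1) / 4) = d - (h + h + h) * h" by (simp add: h_def d_def field_simps)
  have N_ode: "fps_X * N'' + (h + h + h) * N' = h * fps_X * N' + d * N"
  proof (rule fps_ext)
    fix n
    show "fps_nth (fps_X * N'' + (h + h + h) * N') n = fps_nth (h * fps_X * N' + d * N) n"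
      unfolding N''_def N'_def unfolding t[symmetric] unfolding h_def d_def
      unfolding fps_nth_second_order_operator
      using odd_coeff_rec[OF assms, of n, folded N_def] by (simp add: algebra_simps)
  qed
  have dE: "fps_deriv E = - h * E" using mh by (simp add: E_def)
  have dh: "fps_deriv h = 0" by (simp add: h_def)
  have dG: "fps_deriv G = E * N' - h * E * N"
    by (simp add: G_def N'_def dE algebra_simps)
  have dG2: "fps_deriv (fps_deriv G) = E * N'' - (h + h) * E * N' + h * h * E * N"
    unfolding dG by (simp add: N''_def dE dh N'_def[symmetric] algebra_simps)
  have "fps_X * fps_deriv (fps_deriv G) + (h + h + h) * fps_deriv G
     - ((- h) * fps_X * fps_deriv G + (d - (h + h + h) * h) * G)
    = E * (fps_X * N'' + (h + h + h) * N' - h * fps_X * N' - d * N) + fps_X * E * (h * N' - (h + h) * N' + h * N')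
     + (h * h - h * h) * fps_X * E * N"
    unfolding dG2 unfolding dG unfolding G_def by (simp add: algebra_simps)
  also have "\<dots> = 0" unfolding N_ode by (simp add: algebra_simps)
  finally have "fps_X * fps_deriv (fps_deriv G) + (h + h + h) * fps_deriv G
    = (- h) * fps_X * fps_deriv G + (d - (h + h + h) * h) * G" by simp
  then have "fps_nth (fps_X * fps_deriv (fps_deriv G) + fps_const (3 / 2) * fps_deriv G) j
    = fps_nth (fps_const (- 1 / 2) * fps_X * fps_deriv G + fps_const ((p - 1) / 4) * G) j"
    unfolding t mh c by simp
  then show ?thesis
    unfolding fps_nth_second_order_operator smooth_coeff_def G_def E_def N_def by (simp add: algebra_simps)
qed

lemma smooth_coeff_nonzero:
  assumes "p > 0" "\<not> (\<exists>k::int. odd k \<and> p = of_int k)"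
  shows "fps_nth (smooth_coeff p) j \<noteq> 0"
proof (induction j)
  case 0
  show ?case using abs_moment_pos[of "p + 1"] assms by (simp add: smooth_coeff_def odd_coeff_def)
next
  case (Suc j)
  have "(p - 1) / 4 - real j / 2 \<noteq> 0"
  proof
    assume "(p - 1) / 4 - real j / 2 = 0"
    then have "p = of_int (2 * int j + 1)" by simp
    moreover have "odd (2 * int j + 1)" by simp
    ultimately show False using assms(2) by blast
  qed
  then have "((p - 1) / 4 - real j / 2) * fps_nth (smooth_coeff p) j \<noteq> 0" using Suc by simp
  then show ?case using smooth_coeff_rec[OF assms(1), of j] by auto
qed

text \<open>The Cauchy product of the exponential series with the series of \<open>odd_coeff p\<close>.\<close>

lemma gauss_smooth_power_series:
  assumes "p > 0"
  shows "(\<lambda>m. fps_nth (smooth_coeff p) m * y ^ (2 * m + 1)) sums gauss_smooth p y"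
proof (cases "y = 0")
  case True
  have "gauss_smooth p 0 = 0"
    using signed_moment[OF assms, of 0] by (simp add: gauss_smooth_def)
  then show ?thesis using True by simp
next
  case False
  define S where "S = exp (y\<^sup>2 / 2) * gauss_smooth p y"
  have "strict_mono (\<lambda>j::nat. 2 * j + 1)" by (intro strict_monoI) simp
  then have "(\<lambda>j. (if odd (2 * j + 1) then abs_moment (p + real (2 * j + 1)) / fact (2 * j + 1) else 0) * y ^ (2 * j + 1)) sums S"
    unfolding S_def using gauss_smooth_sums[OF assms, of y]
    by (subst sums_mono_reindex) (auto elim!: oddE)
  moreover have "(if odd (2 * j + 1) then abs_moment (p + real (2 * j + 1)) / fact (2 * j + 1) else 0) * y ^ (2 * j + 1)
    = y * (fps_nth (odd_coeff p) j * (y\<^sup>2) ^ j)" for j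
  proof -
    have "y ^ (2 * j + 1) = y * (y\<^sup>2) ^ j" by (simp add: power_mult)
    then show ?thesis by (simp add: odd_coeff_def)
  qed
  ultimately have "(\<lambda>j. y * (fps_nth (odd_coeff p) j * (y\<^sup>2) ^ j)) sums S" by simp
  from sums_divide[OF this, of y] have N: "(\<lambda>j. fps_nth (odd_coeff p) j * (y\<^sup>2) ^ j) sums (S / y)"
    using False by simp
  have nonneg: "0 \<le> fps_nth (odd_coeff p) j * (y\<^sup>2) ^ j" for j
    using abs_moment_pos[of "p + real (2 * j + 1)"] assms by (simp add: odd_coeff_def)
  have E: "(\<lambda>i. fps_nth (fps_exp (- 1 / 2)) i * (y\<^sup>2) ^ i) sums exp (- (y\<^sup>2) / 2)"
  proof -
    have "(- (y\<^sup>2) / 2) ^ i /\<^sub>R fact i = fps_nth (fps_exp (- 1 / 2)) i * (y\<^sup>2) ^ i" for i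
    proof -
      have "(- (y\<^sup>2) / 2) ^ i = (- 1 / 2) ^ i * (y\<^sup>2) ^ i" by (simp flip: power_mult_distrib)
      then show ?thesis
        by (simp only: fps_exp_nth real_scaleR_def of_nat_fact divide_inverse mult.assoc mult.commute mult.left_commute)
    qed
    then show ?thesis using exp_converges[of "- (y\<^sup>2) / 2"] by simp
  qed
  have En: "summable (\<lambda>i. norm (fps_nth (fps_exp (- 1 / 2)) i * (y\<^sup>2) ^ i :: real))"
  proof -
    have "norm (fps_nth (fps_exp (- 1 / 2)) i * (y\<^sup>2) ^ i :: real) = (y\<^sup>2 / 2) ^ i / fact i" for i
      by (simp add: abs_mult power_abs power_divide)
    then show ?thesis using summable_exp[of "y\<^sup>2 / 2"] by (simp only: divide_inverse_commute[of _ "fact _"])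
  qed
  have Nn: "summable (\<lambda>j. norm (fps_nth (odd_coeff p) j * (y\<^sup>2) ^ j))"
    using nonneg N by (simp add: sums_iff)
  have prod: "(\<lambda>k. \<Sum>i\<le>k. (fps_nth (fps_exp (- 1 / 2)) i * (y\<^sup>2) ^ i) * (fps_nth (odd_coeff p) (k - i) * (y\<^sup>2) ^ (k - i)))
    sums (exp (- (y\<^sup>2) / 2) * (S / y))"
    using Cauchy_product_sums[OF En Nn] unfolding sums_unique[OF E, symmetric] sums_unique[OF N, symmetric] .
  have coeff: "(\<Sum>i\<le>k. (fps_nth (fps_exp (- 1 / 2)) i * (y\<^sup>2) ^ i) * (fps_nth (odd_coeff p) (k - i) * (y\<^sup>2) ^ (k - i)))
    = fps_nth (smooth_coeff p) k * (y\<^sup>2) ^ k" for k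
  proof -
    have "(fps_nth (fps_exp (- 1 / 2)) i * (y\<^sup>2) ^ i) * (fps_nth (odd_coeff p) (k - i) * (y\<^sup>2) ^ (k - i))
      = fps_nth (fps_exp (- 1 / 2)) i * fps_nth (odd_coeff p) (k - i) * (y\<^sup>2) ^ k" if "i \<le> k" for i
      using that power_add[of "y\<^sup>2" i "k - i"] by simp
    then show ?thesis
      unfolding smooth_coeff_def fps_mult_nth sum_distrib_right atMost_atLeast0
      by (intro sum.cong) auto
  qed
  have "(\<lambda>k. y * (fps_nth (smooth_coeff p) k * (y\<^sup>2) ^ k)) sums (y * (exp (- (y\<^sup>2) / 2) * (S / y)))"
    by (rule sums_mult[OF prod[unfolded coeff]])
  moreover have "y * (exp (- (y\<^sup>2) / 2) * (S / y)) = gauss_smooth p y"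
  proof -
    have e: "exp (- (y\<^sup>2) / 2) * exp (y\<^sup>2 / 2) = 1"
      using exp_minus_inverse[of "y\<^sup>2 / 2"] by (simp only: mult.commute minus_divide_left)
    have "y * (a * ((b * c) / y)) = (a * b) * c" for a b c using False by simp
    from this[of "exp (- (y\<^sup>2) / 2)" "exp (y\<^sup>2 / 2)" "gauss_smooth p y"]
    show ?thesis unfolding S_def e by simp
  qed
  moreover have "y * (c * (y\<^sup>2) ^ k) = c * y ^ (2 * k + 1)" for c k
    by (simp add: power_mult)
  ultimately show ?thesis by simp
qed

section \<open>Averaging over Gaussian directions\<close>

text \<open>A standard Gaussian vector, given by its coordinates with respect to the standard basis.\<close>

definition gaussian_noise :: "('a::euclidean_space \<Rightarrow> real) measure" where
  "gaussian_noise = (\<Pi>\<^sub>M b\<in>Basis. density lborel std_normal_density)"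

lemma prob_space_gaussian_noise: "prob_space gaussian_noise"
  unfolding gaussian_noise_def by (intro prob_space_PiM prob_space_normal_density) simp

lemma sets_gaussian_noise: "sets gaussian_noise = sets (\<Pi>\<^sub>M b\<in>Basis. borel)"
  unfolding gaussian_noise_def by (intro sets_PiM_cong) auto

lemma gaussian_noise_component_measurable:
  "b \<in> Basis \<Longrightarrow> (\<lambda>x. x b) \<in> borel_measurable gaussian_noise"
  unfolding measurable_cong_sets[OF sets_gaussian_noise refl] by (rule measurable_component_singleton)

lemma gaussian_noise_component:
  assumes b: "(b :: 'a::euclidean_space) \<in> Basis"
  shows "distributed gaussian_noise lborel (\<lambda>x. x b) std_normal_density"
proof -
  have p: "prob_space (density lborel std_normal_density)" by (rule prob_space_normal_density) simp
  have "distr gaussian_noise lborel (\<lambda>x. x b) = distr gaussian_noise (density lborel std_normal_density) (\<lambda>x. x b)"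
    by (rule distr_cong) auto
  also have "\<dots> = density lborel std_normal_density"
    unfolding gaussian_noise_def by (rule distr_PiM_component) (use b p in auto)
  finally show ?thesis
    unfolding distributed_def using gaussian_noise_component_measurable[OF b] by simp
qed

lemma gaussian_noise_indep:
  "prob_space.indep_vars (gaussian_noise :: ('a::euclidean_space \<Rightarrow> real) measure) (\<lambda>_. borel) (\<lambda>b x. x b) Basis"
proof -
  interpret prob_space "gaussian_noise :: ('a \<Rightarrow> real) measure" by (rule prob_space_gaussian_noise)
  have p: "prob_space (density lborel std_normal_density)" by (rule prob_space_normal_density) simp
  have d: "distr (gaussian_noise :: ('a \<Rightarrow> real) measure) borel (\<lambda>x. x b) = density lborel std_normal_density" if "b \<in> Basis" for b
    using gaussian_noise_component[OF that] distr_cong[of gaussian_noise gaussian_noise borel lborel "\<lambda>x. x b" "\<lambda>x. x b"]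
    unfolding distributed_def by simp
  let ?G = "gaussian_noise :: ('a \<Rightarrow> real) measure"
  have "distr ?G (\<Pi>\<^sub>M b\<in>Basis. borel) (\<lambda>x. \<lambda>b\<in>Basis. x b) = distr ?G ?G (\<lambda>x. x)"
  proof (rule distr_cong)
    fix x assume "x \<in> space ?G"
    then have "x \<in> extensional Basis" by (auto simp: gaussian_noise_def space_PiM PiE_iff)
    then show "(\<lambda>b\<in>Basis. x b) = x" by (rule extensional_restrict)
  qed (simp_all add: sets_gaussian_noise)
  also have "\<dots> = ?G" by simp
  also have "?G = (\<Pi>\<^sub>M b\<in>Basis. distr ?G borel (\<lambda>x. x b))"
  proof -
    have "(\<Pi>\<^sub>M b\<in>Basis. distr ?G borel (\<lambda>x. x b)) = (\<Pi>\<^sub>M b\<in>Basis. density lborel std_normal_density)"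
      by (rule PiM_cong) (simp_all add: d)
    then show ?thesis unfolding gaussian_noise_def by simp
  qed
  finally show ?thesis
    by (subst indep_vars_iff_distr_eq_PiM') (auto intro: gaussian_noise_component_measurable)
qed

text \<open>A sum of independent centred normal variables is normal, and the variances \<open>(b \<bullet> v)\<^sup>2\<close> add up to
  1. This is the rotation invariance of the Gaussian: the law does not depend on the unit vector \<open>v\<close>
  except through \<open>w \<bullet> v\<close>. Coordinates with \<open>b \<bullet> v = 0\<close> are left out, because normal densities need
  a positive standard deviation.\<close>

lemma gaussian_noise_projection:
  fixes v w :: "'a::euclidean_space"
  assumes v: "v \<in> sphere 0 1"
  shows "distributed gaussian_noise lborel (\<lambda>x. w \<bullet> v + (\<Sum>b\<in>Basis. x b * (b \<bullet> v))) (normal_density (w \<bullet> v) 1)"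
proof -
  interpret prob_space "gaussian_noise :: ('a \<Rightarrow> real) measure" by (rule prob_space_gaussian_noise)
  define I where "I = {b \<in> Basis. b \<bullet> v \<noteq> 0}"
  have fin: "finite I" "I \<subseteq> Basis" by (auto simp: I_def)
  have ne: "I \<noteq> {}"
  proof
    assume "I = {}"
    then have "\<forall>b\<in>Basis. v \<bullet> b = 0" by (auto simp: I_def inner_commute)
    then show False using v euclidean_all_zero_iff[of v] by auto
  qed
  have "indep_vars (\<lambda>_. borel) (\<lambda>b x. (b \<bullet> v) * x b) I"
    by (rule indep_vars_compose2[OF indep_vars_subset[OF gaussian_noise_indep fin(2)], of "\<lambda>b t. (b \<bullet> v) * t"]) simp
  moreover have "distributed gaussian_noise lborel (\<lambda>x. (b \<bullet> v) * x b) (normal_density 0 \<bar>b \<bullet> v\<bar>)" if "b \<in> I" for b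
    using normal_density_affine[OF gaussian_noise_component, of b "b \<bullet> v" 0] that by (simp add: I_def)
  ultimately have "distributed gaussian_noise lborel (\<lambda>x. \<Sum>b\<in>I. (b \<bullet> v) * x b)
      (normal_density (\<Sum>b\<in>I. 0) (sqrt (\<Sum>b\<in>I. \<bar>b \<bullet> v\<bar>\<^sup>2)))"
    using fin ne by (intro sum_indep_normal) (auto simp: I_def)
  moreover have "(\<Sum>b\<in>I. \<bar>b \<bullet> v\<bar>\<^sup>2) = 1"
  proof -
    have "(\<Sum>b\<in>I. \<bar>b \<bullet> v\<bar>\<^sup>2) = (\<Sum>b\<in>Basis. (v \<bullet> b) * (v \<bullet> b))"
      by (rule sum.mono_neutral_cong_left) (auto simp: I_def power2_eq_square inner_commute)
    also have "\<dots> = v \<bullet> v" by (rule euclidean_inner[symmetric])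
    also have "\<dots> = 1" using v by (simp add: norm_eq_1)
    finally show ?thesis .
  qed
  ultimately have "distributed gaussian_noise lborel (\<lambda>x. \<Sum>b\<in>I. (b \<bullet> v) * x b) std_normal_density" by simp
  from normal_density_affine[OF this, of 1 "w \<bullet> v"]
  have "distributed gaussian_noise lborel (\<lambda>x. w \<bullet> v + (\<Sum>b\<in>I. (b \<bullet> v) * x b)) (normal_density (w \<bullet> v) 1)" by simp
  moreover have "(\<Sum>b\<in>I. (b \<bullet> v) * x b) = (\<Sum>b\<in>Basis. x b * (b \<bullet> v))" for x :: "'a \<Rightarrow> real"
    by (rule sum.mono_neutral_cong_left) (auto simp: I_def)
  ultimately show ?thesis by simp
qed

lemma integrable_signed_powr_normal:
  assumes "p > 0"
  shows "integrable lborel (\<lambda>b. normal_density y 1 b * signed_powr p b)"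
    and "\<bar>y\<bar> \<le> r \<Longrightarrow> (\<integral>b. normal_density y 1 b * \<bar>signed_powr p b\<bar> \<partial>lborel)
      \<le> (\<integral>b. \<bar>b\<bar> powr p * exp (r * \<bar>b\<bar>) * std_normal_density b \<partial>lborel)"
proof -
  have dens: "normal_density y 1 b \<le> exp (r * \<bar>b\<bar>) * std_normal_density b" if "\<bar>y\<bar> \<le> r" for b r
  proof -
    have "normal_density y 1 b \<le> exp (y\<^sup>2 / 2) * normal_density y 1 b"
      using mult_right_mono[of 1 "exp (y\<^sup>2 / 2)" "normal_density y 1 b"] by simp
    also have "\<dots> = std_normal_density b * exp (y * b)" by (rule std_normal_density_exp[symmetric])
    also have "\<dots> \<le> std_normal_density b * exp (r * \<bar>b\<bar>)"
    proof -
      have "y * b \<le> \<bar>y\<bar> * \<bar>b\<bar>" by (metis abs_ge_self abs_mult)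
      also have "\<dots> \<le> r * \<bar>b\<bar>" using that by (intro mult_right_mono) auto
      finally show ?thesis by (intro mult_left_mono) auto
    qed
    finally show ?thesis by (simp add: mult.commute)
  qed
  have le: "normal_density y 1 b * \<bar>signed_powr p b\<bar> \<le> \<bar>b\<bar> powr p * exp (r * \<bar>b\<bar>) * std_normal_density b" if "\<bar>y\<bar> \<le> r" for b r
    using mult_right_mono[OF dens[OF that, of b], of "\<bar>b\<bar> powr p"] by (simp add: abs_signed_powr mult_ac)
  have int: "integrable lborel (\<lambda>b. \<bar>b\<bar> powr p * exp (r * \<bar>b\<bar>) * std_normal_density b)" for r
    using assms by (intro integrable_powr_exp_normal) simp
  show i: "integrable lborel (\<lambda>b. normal_density y 1 b * signed_powr p b)"
  proof (rule Bochner_Integration.integrable_bound[OF int[of "\<bar>y\<bar>"]])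
    show "AE b in lborel. norm (normal_density y 1 b * signed_powr p b)
       \<le> norm (\<bar>b\<bar> powr p * exp (\<bar>y\<bar> * \<bar>b\<bar>) * std_normal_density b)"
      using le[OF order_refl] by (intro AE_I2) (simp add: abs_mult)
  qed simp
  show "(\<integral>b. normal_density y 1 b * \<bar>signed_powr p b\<bar> \<partial>lborel)
      \<le> (\<integral>b. \<bar>b\<bar> powr p * exp (r * \<bar>b\<bar>) * std_normal_density b \<partial>lborel)" if "\<bar>y\<bar> \<le> r"
    using integrable_abs[OF i] le[OF that] by (intro integral_mono int) (auto simp: abs_mult)
qed

text \<open>Average the hypothesis over \<open>u = w + x\<close> with \<open>x\<close> standard Gaussian and exchange the integrals: for
  each \<open>v\<close> on the sphere the average of the kernel is \<open>gauss_smooth p (w \<bullet> v)\<close>. The kernel, in general not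
  smooth at zero, is thereby replaced by an entire one.\<close>

lemma integral_sphere_gauss_smooth_zero:
  fixes g :: "'a::euclidean_space \<Rightarrow> real"
  assumes p: "p > 0" and g: "continuous_on (sphere 0 1) g"
    and zero: "\<And>u. (\<integral>v. signed_powr p (u \<bullet> v) * g v \<partial>spherical_measure) = 0"
  shows "(\<integral>v. g v * gauss_smooth p (w \<bullet> v) \<partial>spherical_measure) = 0"
proof -
  let ?S = "spherical_measure :: 'a measure" and ?G = "gaussian_noise :: ('a \<Rightarrow> real) measure"
  interpret S: finite_measure ?S by (rule finite_measure_spherical_measure)
  interpret G: prob_space ?G by (rule prob_space_gaussian_noise)
  interpret P: pair_sigma_finite ?S ?G ..
  define X where "X v x = w \<bullet> v + (\<Sum>b\<in>Basis. x b * (b \<bullet> v))" for v :: 'a and x :: "'a \<Rightarrow> real"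
  define f where "f v x = signed_powr p (X v x) * g v" for v x
  have id_m: "(\<lambda>v. v) \<in> borel_measurable ?S"
    by (rule continuous_sphere_measurable) (rule continuous_on_id)
  have fst_m: "fst \<in> borel_measurable (?S \<Otimes>\<^sub>M ?G)"
    using measurable_compose[OF measurable_fst id_m] .
  have X_m: "(\<lambda>z. X (fst z) (snd z)) \<in> borel_measurable (?S \<Otimes>\<^sub>M ?G)"
    unfolding X_def
    by (intro borel_measurable_add borel_measurable_inner borel_measurable_const fst_m borel_measurable_sum
      borel_measurable_times measurable_compose[OF measurable_snd gaussian_noise_component_measurable])
  have f_m: "case_prod f \<in> borel_measurable (?S \<Otimes>\<^sub>M ?G)"
    unfolding f_def case_prod_beta
    by (intro borel_measurable_times measurable_compose[OF X_m signed_powr_measurable]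
      measurable_compose[OF measurable_fst continuous_sphere_measurable[OF g]])
  have dist: "distributed ?G lborel (X v) (normal_density (w \<bullet> v) 1)" if "v \<in> sphere 0 1" for v
    unfolding X_def by (rule gaussian_noise_projection[OF that])
  have int_x: "integrable ?G (f v)" if "v \<in> sphere 0 1" for v
    using distributed_integrable[OF dist[OF that], of "signed_powr p"] integrable_signed_powr_normal(1)[OF p, of "w \<bullet> v"]
    unfolding f_def by (intro integrable_mult_left) simp
  have I: "(\<integral>x. f v x \<partial>?G) = g v * gauss_smooth p (w \<bullet> v)" if "v \<in> sphere 0 1" for v
    using distributed_integral[OF dist[OF that], of "signed_powr p"]
    unfolding f_def gauss_smooth_def by (simp add: mult.commute)
  \<comment> \<open>A bound, uniform in \<open>v\<close>, for the average of the absolute kernel.\<close>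
  define C where "C = (\<integral>b. \<bar>b\<bar> powr p * exp (norm w * \<bar>b\<bar>) * std_normal_density b \<partial>lborel)"
  have bound: "(\<integral>x. norm (f v x) \<partial>?G) \<le> C * \<bar>g v\<bar>" if v: "v \<in> sphere 0 1" for v
  proof -
    have "(\<integral>x. norm (f v x) \<partial>?G) = (\<integral>x. \<bar>signed_powr p (X v x)\<bar> \<partial>?G) * \<bar>g v\<bar>"
      unfolding f_def by (simp add: abs_mult)
    also have "(\<integral>x. \<bar>signed_powr p (X v x)\<bar> \<partial>?G) = (\<integral>b. normal_density (w \<bullet> v) 1 b * \<bar>signed_powr p b\<bar> \<partial>lborel)"
      using distributed_integral[OF dist[OF v], of "\<lambda>b. \<bar>signed_powr p b\<bar>"] by simp
    also have "\<dots> \<le> C"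
      unfolding C_def using Cauchy_Schwarz_ineq2[of w v] v
      by (intro integrable_signed_powr_normal(2)[OF p]) simp
    finally show ?thesis by (simp add: mult_right_mono)
  qed
  have "integrable (?S \<Otimes>\<^sub>M ?G) (case_prod f)"
  proof (rule P.Fubini_integrable[OF f_m])
    show "AE v in ?S. integrable ?G (\<lambda>x. case_prod f (v, x))"
      using int_x by (intro AE_I2) simp
    show "integrable ?S (\<lambda>v. \<integral>x. norm (case_prod f (v, x)) \<partial>?G)"
    proof (rule Bochner_Integration.integrable_bound)
      show "integrable ?S (\<lambda>v. C * \<bar>g v\<bar>)"
        using continuous_sphere_integrable[OF g] by simp
      show "(\<lambda>v. \<integral>x. norm (case_prod f (v, x)) \<partial>?G) \<in> borel_measurable ?S"
        using borel_measurable_abs[OF f_m]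
        by (intro G.borel_measurable_lebesgue_integral) (simp add: case_prod_beta)
      show "AE v in ?S. norm (\<integral>x. norm (case_prod f (v, x)) \<partial>?G) \<le> norm (C * \<bar>g v\<bar>)"
      proof (rule AE_I2)
        fix v assume "v \<in> space ?S"
        then have "(\<integral>x. norm (f v x) \<partial>?G) \<le> C * \<bar>g v\<bar>" by (intro bound) simp
        moreover have "0 \<le> (\<integral>x. norm (f v x) \<partial>?G)" by simp
        ultimately show "norm (\<integral>x. norm (case_prod f (v, x)) \<partial>?G) \<le> norm (C * \<bar>g v\<bar>)" by simp
      qed
    qed
  qed
  then have "(\<integral>x. (\<integral>v. f v x \<partial>?S) \<partial>?G) = (\<integral>v. (\<integral>x. f v x \<partial>?G) \<partial>?S)"
    by (rule P.Fubini_integral)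
  moreover have "(\<integral>v. f v x \<partial>?S) = 0" for x
  proof -
    have "X v x = (w + (\<Sum>b\<in>Basis. x b *\<^sub>R b)) \<bullet> v" for v
      by (simp add: X_def inner_add_left inner_sum_left)
    then show ?thesis unfolding f_def using zero by simp
  qed
  moreover have "(\<integral>v. (\<integral>x. f v x \<partial>?G) \<partial>?S) = (\<integral>v. g v * gauss_smooth p (w \<bullet> v) \<partial>?S)"
    using I by (intro Bochner_Integration.integral_cong) simp_all
  ultimately show ?thesis by simp
qed

section \<open>Injectivity of the signed power transform\<close>

text \<open>By induction the lower coefficients vanish; dividing by \<open>s ^ n\<close> and letting \<open>s\<close> tend to 0
  isolates the \<open>n\<close>-th one.\<close>

lemma power_series_zero_coeffs:
  fixes a :: "nat \<Rightarrow> real"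
  assumes "\<And>s. (\<lambda>n. a n * s ^ n) sums 0"
  shows "a n = 0"
proof (induction n rule: less_induct)
  case (less n)
  have "(\<lambda>k. a (k + n) * s ^ k) sums 0" if "s \<noteq> 0" for s
  proof -
    have "(\<lambda>k. a (k + n) * s ^ (k + n)) sums (0 - (\<Sum>i<n. a i * s ^ i))"
      using assms[of s] by (rule sums_split_initial_segment)
    then have "(\<lambda>k. s ^ n * (a (k + n) * s ^ k)) sums 0"
      using less by (simp add: power_add mult_ac)
    then have "(\<lambda>k. (1 / s ^ n) * (s ^ n * (a (k + n) * s ^ k))) sums ((1 / s ^ n) * 0)"
      by (rule sums_mult)
    then show ?thesis using that by simp
  qed
  then have "((\<lambda>s::real. 0::real) \<longlongrightarrow> a (0 + n)) (at 0)"
    using powser_limit_0_strong[of 1 "\<lambda>k. a (k + n)" "\<lambda>_. 0"] by simp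
  then show ?case
    using tendsto_unique[OF _ _ tendsto_const[of 0 "at (0::real)"]] by fastforce
qed

text \<open>Since \<open>\<bar>w \<bullet> v\<bar> \<le> norm w\<close>, the series converges absolutely and uniformly on the sphere.\<close>

lemma integral_sphere_power_series:
  fixes g :: "'a::euclidean_space \<Rightarrow> real"
  assumes g: "continuous_on (sphere 0 1) g" and F: "\<And>y. (\<lambda>n. d n * y ^ n) sums F y"
  shows "(\<lambda>n. d n * (\<integral>v. g v * (w \<bullet> v) ^ n \<partial>spherical_measure)) sums (\<integral>v. g v * F (w \<bullet> v) \<partial>spherical_measure)"
proof -
  have wv: "\<bar>w \<bullet> v\<bar> \<le> norm w" if "v \<in> sphere 0 1" for v
    using Cauchy_Schwarz_ineq2[of w v] that by simp
  have "summable (\<lambda>n. d n * (norm w + 1) ^ n)" using F sums_iff by blast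
  then have sm: "summable (\<lambda>n. norm (d n * norm w ^ n))"
    by (rule powser_insidea) simp
  have int: "integrable spherical_measure (\<lambda>v. g v * (d n * (w \<bullet> v) ^ n))" for n
    by (intro continuous_sphere_integrable continuous_intros g)
  have "(\<lambda>n. \<integral>v. g v * (d n * (w \<bullet> v) ^ n) \<partial>spherical_measure) sums (\<integral>v. g v * F (w \<bullet> v) \<partial>spherical_measure)"
  proof (rule sums_integral_dominated[OF int])
    show "integrable spherical_measure (\<lambda>v. \<bar>g v\<bar> * (\<Sum>n. norm (d n * norm w ^ n)))"
      using continuous_sphere_integrable[OF g] by simp
    show s: "(\<lambda>n. g v * (d n * (w \<bullet> v) ^ n)) sums (g v * F (w \<bullet> v))" for v
      by (intro sums_mult F)
    show "(\<lambda>v. g v * F (w \<bullet> v)) \<in> borel_measurable spherical_measure"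
    proof (rule borel_measurable_LIMSEQ_real)
      show "(\<lambda>n. \<Sum>k<n. g v * (d k * (w \<bullet> v) ^ k)) \<longlonglongrightarrow> g v * F (w \<bullet> v)" for v
        using s[of v] by (simp add: sums_def)
      show "(\<lambda>v. \<Sum>k<n. g v * (d k * (w \<bullet> v) ^ k)) \<in> borel_measurable spherical_measure" for n
        using int by (intro borel_measurable_sum) auto
    qed
    fix n and v :: 'a assume "v \<in> space spherical_measure"
    then have v: "v \<in> sphere 0 1" by simp
    have "(\<Sum>k<n. \<bar>g v * (d k * (w \<bullet> v) ^ k)\<bar>) \<le> (\<Sum>k<n. \<bar>g v\<bar> * norm (d k * norm w ^ k))"
      using wv[OF v] by (intro sum_mono) (auto simp: abs_mult power_abs intro!: mult_left_mono power_mono)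
    also have "\<dots> = \<bar>g v\<bar> * (\<Sum>k<n. norm (d k * norm w ^ k))" by (simp add: sum_distrib_left)
    also have "\<dots> \<le> \<bar>g v\<bar> * (\<Sum>n. norm (d n * norm w ^ n))"
      using sm by (intro mult_left_mono sum_le_suminf) auto
    finally show "(\<Sum>k<n. \<bar>g v * (d k * (w \<bullet> v) ^ k)\<bar>) \<le> \<bar>g v\<bar> * (\<Sum>n. norm (d n * norm w ^ n))" .
  qed
  then show ?thesis by (simp add: mult.left_commute[of "g _"])
qed

text \<open>Linear combinations of exponentials: products of exponentials are exponentials and they separate
  points, which are the hypotheses of Stone--Weierstrass.\<close>

inductive exp_sum :: "('a::euclidean_space \<Rightarrow> real) \<Rightarrow> bool" where
  exp: "exp_sum (\<lambda>v. c * exp (w \<bullet> v))"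
| add: "exp_sum f \<Longrightarrow> exp_sum g \<Longrightarrow> exp_sum (\<lambda>v. f v + g v)"

lemma exp_sum_mult:
  assumes "exp_sum f" "exp_sum g"
  shows "exp_sum (\<lambda>v. f v * g v)"
  using assms
proof (induction f rule: exp_sum.induct)
  case (exp c w)
  from exp.prems show ?case
  proof (induction g rule: exp_sum.induct)
    case (exp c' w')
    have "c * exp (w \<bullet> v) * (c' * exp (w' \<bullet> v)) = (c * c') * exp ((w + w') \<bullet> v)" for v
      by (simp add: inner_add_left exp_add)
    then show ?case by (simp only: exp_sum.exp)
  next
    case (add f g)
    then show ?case using exp_sum.add by (simp add: distrib_left)
  qed
next
  case (add f g)
  then show ?case using exp_sum.add by (simp add: distrib_right)
qed

lemma exp_sum_continuous: "exp_sum f \<Longrightarrow> continuous_on S f"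
  by (induction f rule: exp_sum.induct) (intro continuous_intros; assumption?)+

lemma exp_sum_dense:
  fixes f :: "'a::euclidean_space \<Rightarrow> real"
  assumes "continuous_on (sphere 0 1) f" "e > 0"
  shows "\<exists>q. exp_sum q \<and> (\<forall>v\<in>sphere 0 1. \<bar>f v - q v\<bar> < e)"
proof (rule Stone_Weierstrass_HOL[where P=exp_sum and S="sphere 0 1"])
  show "exp_sum (\<lambda>x. c)" for c using exp_sum.exp[of c 0] by simp
  show "\<exists>f. exp_sum f \<and> f x \<noteq> f y" if "x \<in> sphere 0 1 \<and> y \<in> sphere 0 1 \<and> x \<noteq> y" for x y :: 'a
  proof -
    have "(x - y) \<bullet> (x - y) \<noteq> 0" using that by simp
    then have "(x - y) \<bullet> x \<noteq> (x - y) \<bullet> y" by (simp add: inner_diff_right)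
    then show ?thesis using exp_sum.exp[of 1 "x - y"] by (intro exI[of _ "\<lambda>v. 1 * exp ((x - y) \<bullet> v)"]) simp
  qed
qed (use assms in \<open>auto intro: exp_sum_continuous exp_sum.add exp_sum_mult\<close>)

text \<open>\<open>f\<close> is orthogonal to a dense set of continuous functions, hence to itself.\<close>

lemma zero_if_exponential_integrals_zero:
  fixes f :: "'a::euclidean_space \<Rightarrow> real"
  assumes f: "continuous_on (sphere 0 1) f"
    and zero: "\<And>w. (\<integral>v. f v * exp (w \<bullet> v) \<partial>spherical_measure) = 0"
    and v: "v \<in> sphere 0 1"
  shows "f v = 0"
proof -
  have int: "integrable spherical_measure (\<lambda>v. f v * h v)" if "continuous_on (sphere 0 1) h" for h :: "'a \<Rightarrow> real"
    by (intro continuous_sphere_integrable continuous_on_mult f that)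
  have q0: "(\<integral>v. f v * q v \<partial>spherical_measure) = 0" if "exp_sum q" for q
    using that
  proof (induction q rule: exp_sum.induct)
    case (exp c w)
    have "(\<integral>v. f v * (c * exp (w \<bullet> v)) \<partial>spherical_measure) = (\<integral>v. c * (f v * exp (w \<bullet> v)) \<partial>spherical_measure)"
      by (simp add: mult_ac)
    then show ?case using zero[of w] by simp
  next
    case (add q r)
    have "(\<integral>v. f v * (q v + r v) \<partial>spherical_measure)
      = (\<integral>v. f v * q v \<partial>spherical_measure) + (\<integral>v. f v * r v \<partial>spherical_measure)"
      unfolding distrib_left using add
      by (intro Bochner_Integration.integral_add int exp_sum_continuous)
    then show ?case using add by simp
  qed
  have cont2: "continuous_on (sphere 0 1) (\<lambda>v. f v * f v)" by (intro continuous_on_mult f)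
  define A where "A = (\<integral>v. \<bar>f v\<bar> \<partial>spherical_measure)"
  have A: "A \<ge> 0" unfolding A_def by simp
  have "(\<integral>v. f v * f v \<partial>spherical_measure) \<le> 0"
  proof (rule field_le_epsilon)
    fix e :: real assume e: "e > 0"
    define d where "d = e / (A + 1)"
    have d: "d > 0" using e A by (simp add: d_def)
    obtain q where q: "exp_sum q" "\<And>v. v \<in> sphere 0 1 \<Longrightarrow> \<bar>f v - q v\<bar> < d"
      using exp_sum_dense[OF f d] by blast
    note qc = exp_sum_continuous[OF q(1)]
    have "(\<integral>v. f v * f v \<partial>spherical_measure) = (\<integral>v. f v * f v \<partial>spherical_measure) - (\<integral>v. f v * q v \<partial>spherical_measure)"
      using q0[OF q(1)] by simp
    also have "\<dots> = (\<integral>v. f v * f v - f v * q v \<partial>spherical_measure)"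
      by (rule Bochner_Integration.integral_diff[symmetric]) (intro int f qc)+
    also have "\<dots> \<le> (\<integral>v. d * \<bar>f v\<bar> \<partial>spherical_measure)"
    proof (rule integral_mono)
      show "integrable spherical_measure (\<lambda>v. f v * f v - f v * q v)"
        by (intro Bochner_Integration.integrable_diff int f qc)
      show "integrable spherical_measure (\<lambda>v. d * \<bar>f v\<bar>)"
        using continuous_sphere_integrable[OF f] by simp
      fix v :: 'a assume "v \<in> space spherical_measure"
      then have v: "v \<in> sphere 0 1" by simp
      have "f v * f v - f v * q v = f v * (f v - q v)" by (simp add: right_diff_distrib)
      also have "\<dots> \<le> \<bar>f v\<bar> * \<bar>f v - q v\<bar>" by (metis abs_ge_self abs_mult)
      also have "\<dots> \<le> \<bar>f v\<bar> * d" using q(2)[OF v] by (intro mult_left_mono) auto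
      finally show "f v * f v - f v * q v \<le> d * \<bar>f v\<bar>" by (simp add: mult.commute)
    qed
    also have "\<dots> = d * A" by (simp add: A_def)
    also have "\<dots> \<le> e" using e A by (simp add: d_def field_simps)
    finally show "(\<integral>v. f v * f v \<partial>spherical_measure) \<le> 0 + e" by simp
  qed
  moreover have "0 \<le> (\<integral>v. f v * f v \<partial>spherical_measure)" by simp
  ultimately have "(\<integral>v. f v * f v \<partial>spherical_measure) = 0" by simp
  then have "f v * f v = 0"
    using continuous_nonneg_integral_sphere_zero[OF cont2 _ _ v] by simp
  then show ?thesis by simp
qed

text \<open>Injectivity of the transform with kernel \<^const>\<open>signed_powr\<close> on odd functions. After Gaussian
  averaging, replacing \<open>w\<close> by \<open>s w\<close> and comparing coefficients of powers of \<open>s\<close>, all odd moments of \<open>g\<close> vanish,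
  because no Taylor coefficient of \<^const>\<open>gauss_smooth\<close> of odd order does. Summing these moments, \<open>g\<close>
  is orthogonal to \<open>sinh (w \<bullet> v)\<close> for all \<open>w\<close>, so its odd part is orthogonal to all exponentials.\<close>

theorem even_if_odd_powr_transform_zero:
  fixes g :: "'a::euclidean_space \<Rightarrow> real"
  assumes p: "p > 0" "\<not> (\<exists>k::int. odd k \<and> p = of_int k)"
    and g: "continuous_on (sphere 0 1) g"
    and zero: "\<And>u. (\<integral>v. signed_powr p (u \<bullet> v) * g v \<partial>spherical_measure) = 0"
    and v: "v \<in> sphere 0 1"
  shows "g (- v) = g v"
proof -
  let ?c = "\<lambda>w n. \<integral>v. g v * (w \<bullet> v) ^ n \<partial>spherical_measure"
  \<comment> \<open>The Taylor coefficients of \<open>gauss_smooth p\<close> in \<open>y\<close> rather than \<open>y\<^sup>2\<close>.\<close>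
  define d where "d n = (if odd n then fps_nth (smooth_coeff p) (n div 2) else 0)" for n
  have d_sums: "(\<lambda>n. d n * y ^ n) sums gauss_smooth p y" for y
  proof -
    have "strict_mono (\<lambda>j::nat. 2 * j + 1)" by (intro strict_monoI) simp
    moreover have "(\<lambda>m. d (2 * m + 1) * y ^ (2 * m + 1)) sums gauss_smooth p y"
      using gauss_smooth_power_series[OF p(1), of y] by (simp add: d_def)
    ultimately show ?thesis
      by (subst (asm) sums_mono_reindex[where f="\<lambda>n. d n * y ^ n"]) (auto simp: d_def elim!: oddE)
  qed
  have odd_zero: "?c w n = 0" if "odd n" for w n
  proof -
    have "(\<lambda>n. d n * ?c w n * s ^ n) sums 0" for s
    proof -
      have "(\<lambda>n. d n * ?c (s *\<^sub>R w) n) sums (\<integral>v. g v * gauss_smooth p ((s *\<^sub>R w) \<bullet> v) \<partial>spherical_measure)"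
        by (rule integral_sphere_power_series[OF g d_sums])
      moreover have "(\<integral>v. g v * gauss_smooth p ((s *\<^sub>R w) \<bullet> v) \<partial>spherical_measure) = 0"
        by (rule integral_sphere_gauss_smooth_zero[OF p(1) g zero])
      moreover have "?c (s *\<^sub>R w) n = ?c w n * s ^ n" for n
        by (simp add: power_mult_distrib mult.left_commute[of "g _"] mult.commute)
      ultimately show ?thesis by (simp add: mult.assoc)
    qed
    then have "d n * ?c w n = 0" by (rule power_series_zero_coeffs)
    moreover have "d n \<noteq> 0" using that smooth_coeff_nonzero[OF p] by (simp add: d_def)
    ultimately show ?thesis by simp
  qed
  define D where "D v = g v - g (- v)" for v
  have g': "continuous_on (sphere 0 1) (\<lambda>v. g (- v))"
    by (rule continuous_on_compose2[OF g]) (auto intro!: continuous_intros)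
  have D: "continuous_on (sphere 0 1) D" unfolding D_def by (intro continuous_on_diff g g')
  have "(\<integral>v. D v * exp (w \<bullet> v) \<partial>spherical_measure) = 0" for w
  proof -
    have ec: "continuous_on (sphere 0 1) (\<lambda>v. exp (w \<bullet> v))" for w :: 'a by (intro continuous_intros)
    have int: "integrable spherical_measure (\<lambda>v. g v * exp (w \<bullet> v))" "integrable spherical_measure (\<lambda>v. g (- v) * exp (w \<bullet> v))" for w
      by (intro continuous_sphere_integrable continuous_on_mult g g' ec)+
    have "(\<integral>v. D v * exp (w \<bullet> v) \<partial>spherical_measure)
      = (\<integral>v. g v * exp (w \<bullet> v) \<partial>spherical_measure) - (\<integral>v. g (- v) * exp (w \<bullet> v) \<partial>spherical_measure)"
      unfolding D_def left_diff_distrib by (rule Bochner_Integration.integral_diff[OF int])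
    also have "(\<integral>v. g (- v) * exp (w \<bullet> v) \<partial>spherical_measure) = (\<integral>v. g v * exp ((- w) \<bullet> v) \<partial>spherical_measure)"
      using integral_spherical_measure_uminus[OF continuous_on_mult[OF g ec[of "- w"]]] by simp
    also have "(\<integral>v. g v * exp (w \<bullet> v) \<partial>spherical_measure) - (\<integral>v. g v * exp ((- w) \<bullet> v) \<partial>spherical_measure)
      = (\<integral>v. g v * (exp (w \<bullet> v) - exp (- (w \<bullet> v))) \<partial>spherical_measure)"
      unfolding right_diff_distrib inner_minus_left
      by (rule Bochner_Integration.integral_diff[symmetric]) (use int(1)[of w] int(1)[of "- w"] in simp_all)
    also have "\<dots> = 0"
    proof -
      \<comment> \<open>The series of \<open>2 sinh y\<close>, with coefficient 0 in even degrees.\<close>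
      have "(\<lambda>n. (1 / fact n - (- 1) ^ n / fact n) * y ^ n) sums (exp y - exp (- y))" for y :: real
      proof -
        have "(\<lambda>n. y ^ n /\<^sub>R fact n - (- y) ^ n /\<^sub>R fact n) sums (exp y - exp (- y))"
          by (intro sums_diff exp_converges)
        moreover have "y ^ n /\<^sub>R fact n - (- y) ^ n /\<^sub>R fact n = (1 / fact n - (- 1) ^ n / fact n) * y ^ n" for n
          by (cases "even n") (simp_all add: field_simps)
        ultimately show ?thesis by simp
      qed
      from integral_sphere_power_series[OF g this, of w]
      have "(\<lambda>n. (1 / fact n - (- 1) ^ n / fact n) * ?c w n) sums (\<integral>v. g v * (exp (w \<bullet> v) - exp (- (w \<bullet> v))) \<partial>spherical_measure)" .
      moreover have "(1 / fact n - (- 1) ^ n / fact n) * ?c w n = 0" for n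
        using odd_zero[of n w] by (cases "even n") simp_all
      ultimately show ?thesis by (simp add: sums_iff)
    qed
    finally show ?thesis .
  qed
  then have "D v = 0" by (rule zero_if_exponential_integrals_zero[OF D _ v])
  then show ?thesis by (simp add: D_def)
qed

section \<open>Volume inequalities for the moment bodies\<close>

text \<open>Each point of \<open>L\<close> lies on the segment from the origin to the boundary point in its direction,
  and the reflected boundary point belongs to \<open>L\<close> as well.\<close>

lemma origin_symmetric_if_radial_even:
  fixes L :: "'a::euclidean_space set"
  assumes L: "star_body L" and even: "\<And>v. v \<in> sphere 0 1 \<Longrightarrow> radial L (- v) = radial L v"
  shows "origin_symmetric L"
proof -
  have cL: "compact L" and seg: "\<And>x. x \<in> L \<Longrightarrow> closed_segment 0 x \<subseteq> L" and "0 \<in> L"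
    and pos: "\<And>x. x \<noteq> 0 \<Longrightarrow> 0 < radial L x"
    using L by (auto simp: star_body_def)
  have attained: "radial L v *\<^sub>R v \<in> L" and upper: "\<And>l. 0 \<le> l \<Longrightarrow> l *\<^sub>R v \<in> L \<Longrightarrow> l \<le> radial L v"
    if v: "v \<in> sphere 0 1" for v
  proof -
    let ?A = "{l. 0 \<le> l \<and> l *\<^sub>R v \<in> L}"
    obtain B where B: "\<And>x. x \<in> L \<Longrightarrow> norm x \<le> B"
      using compact_imp_bounded[OF cL] unfolding bounded_iff by metis
    have bdd: "bdd_above ?A"
    proof (rule bdd_aboveI)
      fix l assume "l \<in> ?A"
      then show "l \<le> B" using B[of "l *\<^sub>R v"] v by simp
    qed
    have "closed ((\<lambda>l. l *\<^sub>R v) -` L)"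
      by (rule closed_vimage[OF compact_imp_closed[OF cL]]) (intro continuous_intros)
    then have "closed ({0..} \<inter> (\<lambda>l. l *\<^sub>R v) -` L)" by (intro closed_Int closed_atLeast)
    moreover have "{0..} \<inter> (\<lambda>l. l *\<^sub>R v) -` L = ?A" by auto
    ultimately have "closed ?A" by simp
    moreover have "?A \<noteq> {}" using \<open>0 \<in> L\<close> by (intro ex_in_conv[THEN iffD1] exI[of _ 0]) simp
    ultimately have "Sup ?A \<in> ?A" using bdd by (intro closed_contains_Sup)
    then show "radial L v *\<^sub>R v \<in> L" by (simp add: radial_def)
    show "l \<le> radial L v" if "0 \<le> l" "l *\<^sub>R v \<in> L" for l
      unfolding radial_def using that bdd by (intro cSup_upper) auto
  qed
  have neg: "- x \<in> L" if x: "x \<in> L" for x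
  proof (cases "x = 0")
    case True
    then show ?thesis using \<open>0 \<in> L\<close> by simp
  next
    case False
    define v where "v = x /\<^sub>R norm x"
    define R where "R = radial L (- v)"
    have v: "v \<in> sphere 0 1" "- v \<in> sphere 0 1" using False by (simp_all add: v_def)
    have xv: "x = norm x *\<^sub>R v" using False by (simp add: v_def)
    have "norm x \<le> radial L v" using upper[OF v(1), of "norm x"] x xv by simp
    then have le: "norm x \<le> R" using even[OF v(1)] by (simp add: R_def)
    have R: "R > 0" using le False by (meson less_le_trans zero_less_norm_iff)
    have "R *\<^sub>R (- v) \<in> L" using attained[OF v(2)] by (simp add: R_def)
    moreover have "(norm x / R) *\<^sub>R (R *\<^sub>R (- v)) \<in> closed_segment 0 (R *\<^sub>R (- v))"
      unfolding closed_segment_def using le R by (intro CollectI exI[of _ "norm x / R"]) simp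
    ultimately have "(norm x / R) *\<^sub>R (R *\<^sub>R (- v)) \<in> L" using seg by (metis subsetD)
    moreover have "(norm x / R) *\<^sub>R (R *\<^sub>R (- v)) = - x" using R xv by simp
    ultimately show ?thesis by simp
  qed
  show ?thesis
    unfolding origin_symmetric_def
  proof (intro equalityI subsetI)
    fix x assume "x \<in> L"
    then show "x \<in> uminus ` L" using neg[of x] by (intro image_eqI[of _ _ "- x"]) auto
  next
    fix x assume "x \<in> uminus ` L"
    then show "x \<in> L" using neg by auto
  qed
qed

lemma radial_uminus: "radial (uminus ` L) v = radial L (- v)"
proof -
  have "l *\<^sub>R v \<in> uminus ` L \<longleftrightarrow> l *\<^sub>R (- v) \<in> L" for l
    by (metis imageE imageI minus_minus scaleR_minus_right)
  then show ?thesis by (simp add: radial_def)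
qed

lemma moment_const_pos: "p > 0 \<Longrightarrow> 0 < moment_const n p"
  unfolding moment_const_def by (intro divide_pos_pos mult_pos_pos Gamma_real_pos) auto

lemma phi_tau_powr:
  assumes "\<tau> \<in> {-1..1}" "p > 0"
  shows "phi_tau \<tau> t powr p = (1 + \<tau>) powr p * max t 0 powr p + (1 - \<tau>) powr p * max (- t) 0 powr p"
proof (cases "t \<ge> 0")
  case True
  then have "phi_tau \<tau> t = (1 + \<tau>) * t" by (simp add: phi_tau_def algebra_simps)
  then show ?thesis using True assms by (simp add: powr_mult max_def)
next
  case False
  then have "phi_tau \<tau> t = (1 - \<tau>) * (- t)" by (simp add: phi_tau_def algebra_simps)
  moreover have "((1 - \<tau>) * (- t)) powr p = (1 - \<tau>) powr p * (- t) powr p"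
    by (rule powr_mult)
  moreover have "max t 0 = 0" "max (- t) 0 = - t" using False by simp_all
  ultimately show ?thesis using assms(2) by simp
qed

lemma moment_powr_reflect:
  fixes g :: "'a::euclidean_space \<Rightarrow> real"
  assumes "p > 0" "continuous_on (sphere 0 1) g"
  shows "moment_powr p (\<lambda>v. g (- v)) u = moment_powr p g (- u)"
  using integral_spherical_measure_uminus[OF continuous_on_mult[OF continuous_on_max_inner_powr[OF assms(1)] assms(2)], of "- u"]
  by (simp add: moment_powr_def)

text \<open>The weight of \<open>M\<^sub>p\<^sup>+\<close> when the body for \<open>\<tau>\<close> is written as an \<open>L\<^sub>p\<close> combination of \<open>M\<^sub>p\<^sup>+\<close> and \<open>M\<^sub>p\<^sup>-\<close>.\<close>

definition tau_weight :: "real \<Rightarrow> real \<Rightarrow> real" where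
  "tau_weight p \<tau> = (1 + \<tau>) powr p / ((1 + \<tau>) powr p + (1 - \<tau>) powr p)"

lemma powr_eq_powr_iff: "\<lbrakk>0 \<le> a; 0 \<le> b; 0 < p\<rbrakk> \<Longrightarrow> a powr p = b powr p \<longleftrightarrow> a = (b::real)"
  by (metis less_irrefl linorder_neqE_linordered_idom powr_less_mono2)

lemma tau_weight_props:
  assumes "\<tau> \<in> {-1..1}" "p > 0"
  shows "0 \<le> tau_weight p \<tau>" "tau_weight p \<tau> \<le> 1"
    and "tau_weight p \<tau> = 0 \<longleftrightarrow> \<tau> = -1" "tau_weight p \<tau> = 1 \<longleftrightarrow> \<tau> = 1"
    and "tau_weight p \<tau> = 1 / 2 \<longleftrightarrow> \<tau> = 0"
    and "1 - tau_weight p \<tau> = (1 - \<tau>) powr p / ((1 + \<tau>) powr p + (1 - \<tau>) powr p)"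
proof -
  have "1 + \<tau> > 0 \<or> 1 - \<tau> > 0" by auto
  then have S: "(1 + \<tau>) powr p + (1 - \<tau>) powr p > 0"
    using assms by (metis add_nonneg_pos add_pos_nonneg powr_ge_zero powr_gt_zero less_irrefl)
  show "0 \<le> tau_weight p \<tau>" "tau_weight p \<tau> \<le> 1" using S by (simp_all add: tau_weight_def)
  show "tau_weight p \<tau> = 0 \<longleftrightarrow> \<tau> = -1" "tau_weight p \<tau> = 1 \<longleftrightarrow> \<tau> = 1"
    using S assms by (auto simp: tau_weight_def divide_eq_1_iff)
  show "1 - tau_weight p \<tau> = (1 - \<tau>) powr p / ((1 + \<tau>) powr p + (1 - \<tau>) powr p)"
    using S by (simp add: tau_weight_def field_simps)
  have "tau_weight p \<tau> = 1 / 2 \<longleftrightarrow> (1 + \<tau>) powr p = (1 - \<tau>) powr p"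
    using S by (auto simp: tau_weight_def field_simps)
  also have "\<dots> \<longleftrightarrow> \<tau> = 0" using powr_eq_powr_iff[of "1 + \<tau>" "1 - \<tau>" p] assms by auto
  finally show "tau_weight p \<tau> = 1 / 2 \<longleftrightarrow> \<tau> = 0" .
qed

lemma phi_tau_moment_eq:
  fixes g :: "'a::euclidean_space \<Rightarrow> real"
  assumes \<tau>: "\<tau> \<in> {-1..1}" and p: "p > 0" and g: "continuous_on (sphere 0 1) g"
  shows "moment_const_tau n p \<tau> * (\<integral>v. phi_tau \<tau> (u \<bullet> v) powr p * g v \<partial>spherical_measure)
    = tau_weight p \<tau> * (moment_const n p * moment_powr p g u)
      + (1 - tau_weight p \<tau>) * (moment_const n p * moment_powr p g (- u))"
proof -
  have int: "integrable spherical_measure (\<lambda>v. max (w \<bullet> v) 0 powr p * g v)" for w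
    by (intro continuous_sphere_integrable continuous_on_mult continuous_on_max_inner_powr g p)
  have "(\<integral>v. phi_tau \<tau> (u \<bullet> v) powr p * g v \<partial>spherical_measure)
    = (\<integral>v. (1 + \<tau>) powr p * (max (u \<bullet> v) 0 powr p * g v) + (1 - \<tau>) powr p * (max ((- u) \<bullet> v) 0 powr p * g v) \<partial>spherical_measure)"
    unfolding phi_tau_powr[OF \<tau> p] by (simp add: distrib_right mult.assoc)
  also have "\<dots> = (1 + \<tau>) powr p * moment_powr p g u + (1 - \<tau>) powr p * moment_powr p g (- u)"
    using int[of u] int[of "- u"] by (simp add: moment_powr_def)
  finally show ?thesis
    unfolding tau_weight_props(6)[OF \<tau> p] unfolding tau_weight_def moment_const_tau_def
    by (simp add: add_divide_distrib distrib_left mult_ac)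
qed

text \<open>On unit vectors this is the definition of the kernel; both sides are homogeneous, which gives
  all other \<open>u\<close>. The Gaussian average needs the whole space.\<close>

lemma odd_transform_zero_if_moment_even:
  fixes g :: "'a::euclidean_space \<Rightarrow> real"
  assumes p: "p > 0" and g: "continuous_on (sphere 0 1) g"
    and even: "\<And>u. u \<in> sphere 0 1 \<Longrightarrow> moment_powr p g (- u) = moment_powr p g u"
  shows "(\<integral>v. signed_powr p (u \<bullet> v) * g v \<partial>spherical_measure) = 0"
proof (cases "u = 0")
  case True
  then show ?thesis by (simp add: signed_powr_def)
next
  case False
  define e where "e = u /\<^sub>R norm u"
  have e: "e \<in> sphere 0 1" using False by (simp add: e_def)
  have u: "u = norm u *\<^sub>R e" using False by (simp add: e_def)
  have int: "integrable spherical_measure (\<lambda>v. max (w \<bullet> v) 0 powr p * g v)" for w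
    by (intro continuous_sphere_integrable continuous_on_mult continuous_on_max_inner_powr g p)
  have split: "signed_powr p t = max t 0 powr p - max (- t) 0 powr p" for t
    using p by (cases t "0::real" rule: linorder_cases) (auto simp: signed_powr_def)
  have "signed_powr p (u \<bullet> v) = norm u powr p * signed_powr p (e \<bullet> v)" for v
    by (subst u) (simp add: signed_powr_def abs_mult powr_mult sgn_mult False)
  then have "(\<integral>v. signed_powr p (u \<bullet> v) * g v \<partial>spherical_measure)
    = norm u powr p * (\<integral>v. signed_powr p (e \<bullet> v) * g v \<partial>spherical_measure)"
    by (simp add: mult.assoc)
  also have "(\<integral>v. signed_powr p (e \<bullet> v) * g v \<partial>spherical_measure) = moment_powr p g e - moment_powr p g (- e)"
    unfolding moment_powr_def split left_diff_distrib
    using Bochner_Integration.integral_diff[OF int[of e] int[of "- e"]] by simp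
  also have "\<dots> = 0" using even[OF e] by simp
  finally show ?thesis by simp
qed

text \<open>For \<open>l\<close> between 0 and 1 let \<open>B l\<close> be the \<open>L\<^sub>p\<close> combination of the two nonsymmetric moment
  bodies with weights \<open>l\<close> and \<open>1 - l\<close>. Then \<open>B 1\<close> and \<open>B 0\<close> are the nonsymmetric bodies and
  \<open>B (1 / 2)\<close> is the symmetric one. \<open>B l\<close> is the combination of \<open>B 1\<close> with its reflection, which
  gives the right inequality, and \<open>B (1 / 2)\<close> is the combination of \<open>B l\<close> with its reflection, which gives
  the left one. Unless \<open>\<tau>\<close> is one of the values for which equality is trivial,
  equality makes the function \<open>f\<close> even, and then so is the radial function.\<close>

theorem moment_body_volume_inequalities:
  fixes L :: "'a::euclidean_space set" and p \<tau> :: real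
  assumes p: "1 < p" and L: "star_body L" and \<tau>: "\<tau> \<in> {-1..1}"
  defines "V \<equiv> measure lebesgue"
  shows "V (moment_body p L) \<ge> V (moment_body_tau p \<tau> L)"
    and "V (moment_body_tau p \<tau> L) \<ge> V (moment_body_plus p L)"
    and "V (moment_body_minus p L) = V (moment_body_plus p L)"
    and "\<tau> = 1 \<or> \<tau> = -1 \<Longrightarrow> V (moment_body_tau p \<tau> L) = V (moment_body_plus p L)"
    and "\<lbrakk>\<not> origin_symmetric L; \<not> (\<exists>k::int. odd k \<and> p = of_int k); V (moment_body p L) = V (moment_body_tau p \<tau> L)\<rbrakk>
      \<Longrightarrow> \<tau> = 0"
    and "\<lbrakk>\<not> origin_symmetric L; \<not> (\<exists>k::int. odd k \<and> p = of_int k); V (moment_body_tau p \<tau> L) = V (moment_body_plus p L)\<rbrakk>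
      \<Longrightarrow> \<tau> = 1 \<or> \<tau> = -1"
proof -
  have p0: "p > 0" using p by simp
  define q where "q = real DIM('a) + p"
  have q: "q > 0" using p by (simp add: q_def)
  define g where "g v = radial L v powr q" for v
  have rad: "0 < radial L v" if "v \<in> sphere 0 1" for v
  proof -
    have "v \<noteq> 0" using that by auto
    then show ?thesis using L by (simp add: star_body_def)
  qed
  have g_cont: "continuous_on (sphere 0 1) g"
    unfolding g_def
  proof (rule continuous_on_powr')
    show "continuous_on (sphere 0 1) (radial L)"
    proof (rule continuous_on_subset)
      show "continuous_on (- {0}) (radial L)" using L by (simp add: star_body_def)
    qed auto
    show "continuous_on (sphere 0 1) (\<lambda>v. q)" by (rule continuous_on_const)
    show "\<forall>v\<in>sphere 0 1. 0 \<le> radial L v \<and> (radial L v = 0 \<longrightarrow> 0 < q)"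
      using rad q by (simp add: less_imp_le)
  qed
  have g_pos: "0 < g v" if "v \<in> sphere 0 1" for v using rad[OF that] by (simp add: g_def)
  have g'_cont: "continuous_on (sphere 0 1) (\<lambda>v. g (- v))"
    by (rule continuous_on_compose2[OF g_cont]) (auto intro!: continuous_intros)
  define c where "c = moment_const DIM('a) p"
  have c: "c > 0" unfolding c_def by (rule moment_const_pos[OF p0])
  define f where "f u = c * moment_powr p g u" for u
  define h where "h l u = l * f u + (1 - l) * f (- u)" for l u
  have body: "has_support_powr p (h l) (body_of_support_powr p (h l))" if l: "0 \<le> l" "l \<le> 1" for l
  proof -
    \<comment> \<open>The density whose moment body is \<open>B l\<close>.\<close>
    define G where "G v = l * g v + (1 - l) * g (- v)" for v
    have "continuous_on (sphere 0 1) G"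
      unfolding G_def by (intro continuous_on_add continuous_on_mult continuous_on_const g_cont g'_cont)
    moreover have "0 < G v" if v: "v \<in> sphere 0 1" for v
    proof -
      have "0 < g v" "0 < g (- v)" using g_pos[of v] g_pos[of "- v"] v by auto
      then show ?thesis
        using l unfolding G_def by (cases "l = 0") (auto intro: add_pos_nonneg mult_pos_pos mult_nonneg_nonneg less_imp_le)
    qed
    ultimately obtain K where "has_support_powr p (\<lambda>u. c * moment_powr p G u) K"
      using exists_moment_body[OF p c] by blast
    moreover have "c * moment_powr p G u = h l u" for u
    proof -
      have int: "integrable spherical_measure (\<lambda>v. max (u \<bullet> v) 0 powr p * k v)" if "continuous_on (sphere 0 1) k" for k
        by (intro continuous_sphere_integrable continuous_on_mult continuous_on_max_inner_powr that p0)
      have "moment_powr p G u = (\<integral>v. l * (max (u \<bullet> v) 0 powr p * g v) + (1 - l) * (max (u \<bullet> v) 0 powr p * g (- v)) \<partial>spherical_measure)"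
        unfolding moment_powr_def G_def by (simp add: distrib_left mult.left_commute)
      also have "\<dots> = l * moment_powr p g u + (1 - l) * moment_powr p (\<lambda>v. g (- v)) u"
        using int[OF g_cont] int[OF g'_cont] by (simp add: moment_powr_def)
      finally show ?thesis
        unfolding h_def f_def moment_powr_reflect[OF p0 g_cont] by (simp add: distrib_left mult_ac)
    qed
    ultimately have "has_support_powr p (h l) K" by simp
    then show ?thesis using body_of_support_powr_eq[OF _ p0] by metis
  qed
  define B where "B l = body_of_support_powr p (h l)" for l
  note B = body[folded B_def]
  have V_B: "V (B l) = measure lborel (B l)" if "0 \<le> l" "l \<le> 1" for l
  proof -
    have "compact (B l)" using B[OF that] unfolding has_support_powr_def by (rule conjunct1)
    then show ?thesis by (simp add: V_def borel_compact)
  qed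
  define l where "l = tau_weight p \<tau>"
  note tw = tau_weight_props[OF \<tau> p0, folded l_def]
  have tau_B: "moment_body_tau p t L = B (tau_weight p t)" if "t \<in> {-1..1}" for t
    unfolding moment_body_tau_def B_def
    using phi_tau_moment_eq[OF that p0 g_cont, of "DIM('a)"]
    by (simp add: g_def[abs_def] q_def h_def[abs_def] f_def c_def)
  have half: "tau_weight p 0 = 1 / 2" using tau_weight_props(5)[of 0 p] p0 by simp
  have sym_B: "moment_body p L = B (1 / 2)" unfolding moment_body_def using tau_B[of 0] half by simp
  have plus_B: "moment_body_plus p L = B 1"
    unfolding moment_body_plus_def B_def h_def f_def c_def moment_powr_def g_def q_def by simp
  have minus_B: "moment_body_minus p L = B 0"
  proof -
    have "(\<integral>v. max (u \<bullet> v) 0 powr p * radial (uminus ` L) v powr q \<partial>spherical_measure) = moment_powr p g (- u)" for u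
      using moment_powr_reflect[OF p0 g_cont, of u] by (simp add: moment_powr_def g_def radial_uminus)
    then show ?thesis
      unfolding moment_body_minus_def moment_body_plus_def B_def h_def f_def c_def q_def by simp
  qed
  have "has_support_powr p (h 0) (uminus ` B 1)"
  proof -
    have "h 0 = (\<lambda>u. h 1 (- u))" by (rule ext) (simp add: h_def)
    then show ?thesis using has_support_powr_uminus[OF B[of 1]] by simp
  qed
  then have "B 0 = uminus ` B 1" unfolding B_def[of 0] by (rule body_of_support_powr_eq[OF _ p0])
  moreover have "compact (B 1)" using B[of 1] by (simp add: has_support_powr_def)
  ultimately have V01: "V (B 0) = V (B 1)" using V_B[of 0] V_B[of 1] measure_uminus_compact by simp
  \<comment> \<open>\<open>h l\<close> and its reflection average to \<open>h (1 / 2)\<close>, so \<open>B (1 / 2)\<close> is a combination of \<open>B l\<close> with \<open>- B l\<close>.\<close>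
  have h_half: "h (1 / 2) = (\<lambda>u. (1 / 2) * h l u + (1 - 1 / 2) * h l (- u))"
    by (rule ext) (simp add: h_def field_simps)
  have B_half: "has_support_powr p (\<lambda>u. (1 / 2) * h l u + (1 - 1 / 2) * h l (- u)) (B (1 / 2))"
    using B[of "1 / 2"] unfolding h_half[symmetric] by simp
  have B_l: "has_support_powr p (\<lambda>u. l * h 1 u + (1 - l) * h 1 (- u)) (B l)"
    using B[OF tw(1,2)] unfolding h_def by simp
  note left = volume_Firey_symmetrization[OF B[OF tw(1,2)] B_half p]
  note right = volume_Firey_symmetrization[OF B[of 1] B_l p]
  have even_imp_symmetric: "origin_symmetric L"
    if "\<And>u. u \<in> sphere 0 1 \<Longrightarrow> f (- u) = f u" "\<not> (\<exists>k::int. odd k \<and> p = of_int k)"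
  proof (rule origin_symmetric_if_radial_even[OF L])
    have "moment_powr p g (- u) = moment_powr p g u" if "u \<in> sphere 0 1" for u
      using \<open>\<And>u. u \<in> sphere 0 1 \<Longrightarrow> f (- u) = f u\<close>[OF that] c by (simp add: f_def)
    note zero = odd_transform_zero_if_moment_even[OF p0 g_cont this]
    fix v :: 'a assume v: "v \<in> sphere 0 1"
    then have "- v \<in> sphere 0 1" by simp
    have "g (- v) = g v" by (rule even_if_odd_powr_transform_zero[OF p0 that(2) g_cont zero v])
    then show "radial L (- v) = radial L v"
      using rad[OF v] rad[OF \<open>- v \<in> _\<close>] q by (simp add: g_def powr_eq_powr_iff)
  qed
  show minus: "V (moment_body_minus p L) = V (moment_body_plus p L)"
    unfolding minus_B plus_B by (rule V01)
  show "V (moment_body p L) \<ge> V (moment_body_tau p \<tau> L)"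
    unfolding sym_B tau_B[OF \<tau>] l_def[symmetric] using left(1) V_B[of "1 / 2"] V_B[OF tw(1,2)] by simp
  show ends: "V (moment_body_tau p \<tau> L) = V (moment_body_plus p L)" if "\<tau> = 1 \<or> \<tau> = -1"
  proof -
    have "l = 1 \<or> l = 0" using that tw(3,4) by metis
    then have "V (B l) = V (B 1)" using V01 by metis
    then show ?thesis unfolding plus_B tau_B[OF \<tau>] l_def .
  qed
  show "V (moment_body_tau p \<tau> L) \<ge> V (moment_body_plus p L)"
  proof (cases "\<tau> = 1 \<or> \<tau> = -1")
    case False
    then have "0 < l" "l < 1" using tw(1-4) by linarith+
    then show ?thesis
      unfolding plus_B tau_B[OF \<tau>] l_def[symmetric] using right(1) V_B[of 1] V_B[OF tw(1,2)] by simp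
  next
    case True
    then show ?thesis using ends by simp
  qed
  show "\<tau> = 0" if ns: "\<not> origin_symmetric L" "\<not> (\<exists>k::int. odd k \<and> p = of_int k)"
    and eq: "V (moment_body p L) = V (moment_body_tau p \<tau> L)"
  proof (rule ccontr)
    assume "\<tau> \<noteq> 0"
    then have l2: "l \<noteq> 1 / 2" using tw(5) by simp
    have "measure lborel (B (1 / 2)) = measure lborel (B l)"
      using eq V_B[of "1 / 2"] V_B[OF tw(1,2)] unfolding sym_B tau_B[OF \<tau>] l_def[symmetric] by simp
    then have hl: "h l (- u) = h l u" if "u \<in> sphere 0 1" for u using left(2)[OF _ _ _ that] by simp
    have "f (- u) = f u" if "u \<in> sphere 0 1" for u
    proof -
      have "(2 * l - 1) * (f (- u) - f u) = 0" using hl[OF that] by (simp add: h_def algebra_simps)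
      then show ?thesis using l2 by simp
    qed
    then show False using even_imp_symmetric ns by blast
  qed
  show "\<tau> = 1 \<or> \<tau> = -1" if ns: "\<not> origin_symmetric L" "\<not> (\<exists>k::int. odd k \<and> p = of_int k)"
    and eq: "V (moment_body_tau p \<tau> L) = V (moment_body_plus p L)"
  proof (rule ccontr)
    assume "\<not> (\<tau> = 1 \<or> \<tau> = -1)"
    then have l: "0 < l" "l < 1" using tw(1-4) by linarith+
    have "measure lborel (B l) = measure lborel (B 1)"
      using eq V_B[of 1] V_B[OF tw(1,2)] unfolding plus_B tau_B[OF \<tau>] l_def[symmetric] by simp
    then have "h 1 (- u) = h 1 u" if "u \<in> sphere 0 1" for u using right(2)[OF _ _ l _ that] by simp
    then have "f (- u) = f u" if "u \<in> sphere 0 1" for u using that by (simp add: h_def)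
    then show False using even_imp_symmetric ns by blast
  qed
qed

theorem theorem6p5:
  fixes L :: "(real ^ 'n) set" and p \<tau> :: real
  assumes "CARD('n) \<ge> 3" and "1 < p"
    and "star_body L" and "\<tau> \<in> {-1..1}"
  shows "measure lebesgue (moment_body p L) \<ge> measure lebesgue (moment_body_tau p \<tau> L)
    \<and> measure lebesgue (moment_body_tau p \<tau> L) \<ge> measure lebesgue (moment_body_plus p L)
    \<and> measure lebesgue (moment_body_tau p \<tau> L) \<ge> measure lebesgue (moment_body_minus p L)
    \<and> (\<not> origin_symmetric L \<and> \<not> (\<exists>k::int. odd k \<and> p = of_int k) \<longrightarrow>
        (measure lebesgue (moment_body p L) = measure lebesgue (moment_body_tau p \<tau> L)
           \<longleftrightarrow> \<tau> = 0)
      \<and> (measure lebesgue (moment_body_tau p \<tau> L) = measure lebesgue (moment_body_plus p L)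
           \<longleftrightarrow> \<tau> = 1 \<or> \<tau> = -1)
      \<and> (measure lebesgue (moment_body_tau p \<tau> L) = measure lebesgue (moment_body_minus p L)
           \<longleftrightarrow> \<tau> = 1 \<or> \<tau> = -1))"
proof -
  note main = moment_body_volume_inequalities[OF assms(2,3,4)]
  have "moment_body p L = moment_body_tau p 0 L" by (rule moment_body_def)
  then show ?thesis using main by auto
qed

end
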